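(* Let $k$ be a field of characteristic zero, $R=k[x_0,\ldots,x_n]$, and let $f\in R$ be the determinant of the generic sub-Hankel matrix of order $n$. Let $J$ be the gradient ideal of $f$. Then the associated primes of $R/J$ are $(x_{n-1},x_n)$ and $(x_{n-2},x_{n-1},x_n)$.
   Context: The generic sub-Hankel matrix of order $n$ on the variables $x_0,\ldots,x_n$ is the $n\times n$ matrix whose $(i,j)$ entry ($0\le i,j\le n-1$) is $x_{i+j}$ if $i+j\le n$ and $0$ if $i+j>n$. The gradient ideal of $f$ is the ideal generated by $\partial f/\partial x_0,\ldots,\partial f/\partial x_n$.
   Formalization: The order n is required to be at least 3: for n = 2 the gradient ideal of x_0x_2 - x_1^2 is (x_0,x_1,x_2), whose only associated prime is itself, so the claim fails, and for n = 1 the variable x_{n-2} does not exist. *)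

theory Defs
  imports
    "HOL-Library.Poly_Mapping"
    "HOL-Algebra.QuotRing"
    "HOL-Algebra.Module"
    "Jordan_Normal_Form.Determinant"
begin

text \<open>
  A polynomial in variables indexed by the natural numbers is a finitely supported map from
  exponent vectors to coefficients; its multiplication is the convolution product of
  \<^theory>\<open>HOL-Library.Poly_Mapping\<close>.
\<close>

type_synonym 'k mpoly = "(nat \<Rightarrow>\<^sub>0 nat) \<Rightarrow>\<^sub>0 'k"

definition Var :: "nat \<Rightarrow> 'k::comm_ring_1 mpoly" where
  "Var i = Poly_Mapping.single (Poly_Mapping.single i 1) 1"

text \<open>The ring \<open>k[x\<^sub>0, \<dots>, x\<^sub>n]\<close>, in \<open>n + 1\<close> variables.\<close>

definition poly_ring :: "nat \<Rightarrow> ('k::comm_ring_1 mpoly) ring" where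
  "poly_ring n =
     \<lparr>carrier = {p. \<forall>m \<in> Poly_Mapping.keys p. Poly_Mapping.keys m \<subseteq> {0..n}},
      monoid.mult = (*), one = 1, zero = 0, add = (+)\<rparr>"

text \<open>
  The subtraction of exponent vectors truncates at zero; the affected monomials, those not
  containing \<open>x\<^sub>i\<close>, have coefficient zero.
\<close>

definition partial_deriv :: "nat \<Rightarrow> 'k::comm_ring_1 mpoly \<Rightarrow> 'k mpoly" where
  "partial_deriv i p =
     (\<Sum>m \<in> Poly_Mapping.keys p.
        Poly_Mapping.single (m - Poly_Mapping.single i 1)
          (of_nat (Poly_Mapping.lookup m i) * Poly_Mapping.lookup p m))"

definition sub_Hankel :: "nat \<Rightarrow> 'k::comm_ring_1 mpoly mat" where
  "sub_Hankel n = mat n n (\<lambda>(i, j). if i + j \<le> n then Var (i + j) else 0)"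

definition gradient_ideal :: "nat \<Rightarrow> 'k::comm_ring_1 mpoly \<Rightarrow> 'k mpoly set" where
  "gradient_ideal n f = Idl\<^bsub>poly_ring n\<^esub> {partial_deriv i f | i. i \<le> n}"

text \<open>The quotient ring \<open>R / J\<close> with its structure of a module over \<open>R\<close>.\<close>

definition quotient_module :: "('a, 'b) ring_scheme \<Rightarrow> 'a set \<Rightarrow> ('a, 'a set) module" where
  "quotient_module R J =
     \<lparr>carrier = carrier (R Quot J), monoid.mult = monoid.mult (R Quot J), one = one (R Quot J),
      zero = zero (R Quot J), add = add (R Quot J),
      module.smult = (\<lambda>a X. (J +>\<^bsub>R\<^esub> a) \<otimes>\<^bsub>R Quot J\<^esub> X)\<rparr>"

definition annihilator :: "('a, 'b) ring_scheme \<Rightarrow> ('a, 'c, 'd) module_scheme \<Rightarrow> 'c \<Rightarrow> 'a set" where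
  "annihilator R M x = {a \<in> carrier R. a \<odot>\<^bsub>M\<^esub> x = \<zero>\<^bsub>M\<^esub>}"

definition associated_primes ::
    "('a, 'b) ring_scheme \<Rightarrow> ('a, 'c, 'd) module_scheme \<Rightarrow> 'a set set" where
  "associated_primes R M = {P. primeideal P R \<and> (\<exists>x \<in> carrier M. P = annihilator R M x)}"

lemma lookup_partial_deriv:
  "Poly_Mapping.lookup (partial_deriv i p) m =
     of_nat (Poly_Mapping.lookup m i + 1) * Poly_Mapping.lookup p (m + Poly_Mapping.single i 1)"
proof -
  let ?e = "Poly_Mapping.single i (1::nat)"
  have eq: "(if m' - ?e = m then of_nat (Poly_Mapping.lookup m' i) * Poly_Mapping.lookup p m' else 0)
      = (if m' = m + ?e then of_nat (Poly_Mapping.lookup m' i) * Poly_Mapping.lookup p m' else 0)" for m'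
  proof (cases "Poly_Mapping.lookup m' i = 0")
    case False
    have "m' - ?e + ?e = m'"
      by (rule poly_mapping_eqI)
        (use False in \<open>auto simp: lookup_add lookup_minus lookup_single when_def\<close>)
    then have "m' - ?e = m \<longleftrightarrow> m' = m + ?e"
      by (metis add_diff_cancel_right')
    then show ?thesis by simp
  qed simp
  have "Poly_Mapping.lookup (partial_deriv i p) m =
     (\<Sum>m' \<in> Poly_Mapping.keys p. if m' - ?e = m
        then of_nat (Poly_Mapping.lookup m' i) * Poly_Mapping.lookup p m' else 0)"
    by (simp add: partial_deriv_def lookup_sum lookup_single when_def)
  also have "\<dots> = (\<Sum>m' \<in> Poly_Mapping.keys p. if m' = m + ?e
        then of_nat (Poly_Mapping.lookup m' i) * Poly_Mapping.lookup p m' else 0)"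
    by (simp only: eq)
  also have "\<dots> = of_nat (Poly_Mapping.lookup m i + 1) * Poly_Mapping.lookup p (m + ?e)"
    by (auto simp: sum.delta lookup_add in_keys_iff)
  finally show ?thesis .
qed

lemma poly_ring_simps:
  "add (poly_ring n) = (+)" "monoid.mult (poly_ring n) = (*)"
  "zero (poly_ring n) = 0" "one (poly_ring n) = 1"
  by (simp_all add: poly_ring_def)

lemma cring_poly_ring: "cring (poly_ring n :: ('k::comm_ring_1 mpoly) ring)"
proof -
  let ?C = "carrier (poly_ring n :: 'k mpoly ring)"
  have add: "x + y \<in> ?C" if "x \<in> ?C" "y \<in> ?C" for x y
    using that Poly_Mapping.keys_add[of x y] unfolding poly_ring_def by auto
  have uminus: "- x \<in> ?C" if "x \<in> ?C" for x
    using that by (simp add: poly_ring_def in_keys_iff)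
  have mult: "x * y \<in> ?C" if "x \<in> ?C" "y \<in> ?C" for x y
  proof -
    have "Poly_Mapping.keys m \<subseteq> {0..n}" if m: "m \<in> Poly_Mapping.keys (x * y)" for m
    proof -
      obtain a b where ab: "m = a + b" "a \<in> Poly_Mapping.keys x" "b \<in> Poly_Mapping.keys y"
        using m Poly_Mapping.keys_mult[of x y] by blast
      then have "Poly_Mapping.keys a \<subseteq> {0..n}" "Poly_Mapping.keys b \<subseteq> {0..n}"
        using \<open>x \<in> ?C\<close> \<open>y \<in> ?C\<close> by (simp_all add: poly_ring_def)
      then show ?thesis
        using Poly_Mapping.keys_add[of a b] unfolding ab(1) by blast
    qed
    then show ?thesis by (simp add: poly_ring_def)
  qed
  have zero: "0 \<in> ?C" and one: "1 \<in> ?C"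
    by (simp_all add: poly_ring_def)
  have "abelian_group (poly_ring n :: 'k mpoly ring)"
  proof (rule abelian_groupI, unfold poly_ring_simps)
    fix x :: "'k mpoly" assume "x \<in> ?C"
    then show "\<exists>y\<in>?C. y + x = 0"
      by (intro bexI[of _ "- x"] uminus) simp_all
  qed (fact add zero | rule add.assoc add.commute add_0_left)+
  moreover have "comm_monoid (poly_ring n :: 'k mpoly ring)"
    by (rule comm_monoidI, unfold poly_ring_simps)
      (fact mult one | rule mult.assoc mult.commute mult_1_left)+
  ultimately show ?thesis
    by (rule cringI) (simp add: poly_ring_simps distrib_right)
qed

lemma (in cring) module_quotient_module:
  assumes "ideal J R"
  shows "module R (quotient_module R J)"
proof -
  interpret J: ideal J R by fact
  interpret Q: ring "R Quot J" by (rule J.quotient_is_ring)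
  have "ring_hom_ring R (R Quot J) ((+>) J)" by (rule J.rcos_ring_hom_ring)
  then interpret h: ring_hom_ring R "R Quot J" "(+>) J" .
  have one: "J +> \<one> = \<one>\<^bsub>R Quot J\<^esub>" by (rule h.hom_one)
  have fields: "carrier (quotient_module R J) = carrier (R Quot J)"
    "add (quotient_module R J) = add (R Quot J)"
    "zero (quotient_module R J) = zero (R Quot J)"
    "a \<odot>\<^bsub>quotient_module R J\<^esub> X = (J +> a) \<otimes>\<^bsub>R Quot J\<^esub> X" for a X
    by (simp_all only: quotient_module_def partial_object.simps monoid.simps ring.simps module.simps)
  have "abelian_group (quotient_module R J)"
    by (rule abelian_groupI, unfold fields)
      (fact Q.a_closed Q.zero_closed Q.a_assoc Q.a_comm Q.l_zero Q.add.l_inv_ex)+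
  then show ?thesis
    by (intro moduleI[OF is_cring], unfold fields)
      (simp_all only: h.hom_closed h.hom_add h.hom_mult one Q.m_closed Q.l_distr Q.r_distr
        Q.m_assoc Q.l_one)
qed

end

theory Submission
  imports Defs "HOL-Computational_Algebra.Formal_Power_Series"
begin

text \<open>
  Number the variables backwards, \<open>y\<^sub>k = x\<^sub>n\<^sub>-\<^sub>k\<close>, and put \<open>P = (y\<^sub>0, y\<^sub>1)\<close> and \<open>Q = (y\<^sub>0, y\<^sub>1, y\<^sub>2)\<close>.
  Expanding the determinant along its last row shows that, up to sign, \<open>f\<close> is the coefficient of
  \<open>t\<^sup>n\<close> in \<open>1 / Y\<close>, where \<open>Y = 1 + \<Sum>\<^sub>k\<^sub>\<ge>\<^sub>1 y\<^sub>k y\<^sub>0\<^bsup>k-1\<^esup> t\<^sup>k\<close>. Every derivation \<open>D\<close> of the coefficients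
  satisfies \<open>D (1 / Y) = - D Y / Y\<^sup>2\<close>. So, if \<open>G\<^sub>m\<close> is the coefficient of \<open>t\<^sup>m\<close> in \<open>1 / Y\<^sup>2\<close>, the
  derivative of \<open>f\<close> by \<open>y\<^sub>k\<close> is \<open>y\<^sub>0\<^bsup>k-1\<^esup> G\<^sub>n\<^sub>-\<^sub>k\<close> up to sign if \<open>k \<ge> 1\<close>, and the derivative by \<open>y\<^sub>0\<close> is, up to
  sign, \<open>E = \<Sum>\<^sub>k\<^sub>\<ge>\<^sub>2 (k - 1) y\<^sub>k y\<^sub>0\<^bsup>k-2\<^esup> G\<^sub>n\<^sub>-\<^sub>k\<close>. The identity \<open>Y (1 / Y\<^sup>2)' = - 2 Y' / Y\<^sup>2\<close> is a
  recurrence for the \<open>G\<^sub>m\<close>, in which every coefficient that has to be inverted is a nonzero integer; this is where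
  characteristic zero enters.

  Let \<open>I\<^sub>m\<close> be the ideal generated by \<open>y\<^sub>0\<^sup>k G\<^sub>m\<^sub>-\<^sub>1\<^sub>-\<^sub>k\<close> for \<open>k < m\<close>, so that \<open>J = I\<^sub>n + (E)\<close>. The proof studies
  the larger family of ideals \<open>K = I\<^sub>j\<^sub>+\<^sub>2 + (E)\<close> with \<open>E = u y\<^sub>2\<^sup>a G\<^sub>j + y\<^sub>0 F\<close>, \<open>u\<close> a unit and
  \<open>F \<in> I\<^sub>j\<close>; for \<open>J\<close>, \<open>j = n - 2\<close> and \<open>a = 1\<close>. Two things happen at such an ideal:

  \<^item> modulo \<open>y\<^sub>0\<close>, each \<open>G\<^sub>m\<close> is a unit times \<open>y\<^sub>1\<^sup>m\<close>, hence
    \<open>K + (y\<^sub>0)\<close> is the ideal \<open>(y\<^sub>0, y\<^sub>1\<^bsup>j+1\<^esup>, y\<^sub>1\<^sup>j y\<^sub>2\<^sup>a)\<close>, whose associated primes are among \<open>P\<close> and \<open>Q\<close>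
    (\<open>monomial_ideal_assoc\<close>);
  \<^item> the quotient \<open>K : y\<^sub>0\<close> belongs to the same family, with \<open>j\<close> lowered and \<open>a\<close> raised by one
    (\<open>K_colon_y0\<close>). By the recurrence, \<open>y\<^sub>1 E\<close> is a combination of \<open>G\<^sub>j\<^sub>+\<^sub>1\<close> and a multiple of \<open>y\<^sub>0\<close>,
    and the cofactor of \<open>y\<^sub>0\<close> is the next \<open>E\<close>, up to an element of \<open>I\<^sub>j\<^sub>+\<^sub>1\<close>.

  By the exact sequence \<open>0 \<rightarrow> R / (K : y\<^sub>0) \<rightarrow> R / K \<rightarrow> R / (K + (y\<^sub>0)) \<rightarrow> 0\<close> and induction on \<open>j\<close>, the associated
  primes of \<open>R / K\<close> are among \<open>P\<close> and \<open>Q\<close> (\<open>K_assoc\<close>). Both occur: after \<open>n - 2\<close> divisions by \<open>y\<^sub>0\<close>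
  the gradient ideal has become \<open>(y\<^sub>0, y\<^sub>1, y\<^sub>2\<^bsup>n-1\<^esup>)\<close>, which a further division by \<open>y\<^sub>2\<^bsup>n-2\<^esup>\<close> turns into
  \<open>Q\<close> (\<open>witness_Q\<close>); one step earlier, a power of \<open>y\<^sub>2\<close> kills the \<open>Q\<close>-primary part and
  leaves \<open>P\<close> (\<open>witness_P\<close>).
\<close>

section \<open>Ideals of a subring\<close>

text \<open>
  Subrings of a ring type, rather than carriers of structures, so that computations can use the
  arithmetic of the type.
\<close>

locale unital_subring =
  fixes C :: "'a::comm_ring_1 set"
  assumes one_C: "1 \<in> C"
    and add_C: "a \<in> C \<Longrightarrow> b \<in> C \<Longrightarrow> a + b \<in> C"
    and mult_C: "a \<in> C \<Longrightarrow> b \<in> C \<Longrightarrow> a * b \<in> C"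
    and uminus_C: "a \<in> C \<Longrightarrow> - a \<in> C"
begin

lemma zero_C: "0 \<in> C"
  using add_C[OF one_C uminus_C[OF one_C]] by simp

lemma diff_C: "a \<in> C \<Longrightarrow> b \<in> C \<Longrightarrow> a - b \<in> C"
  using add_C[of a "- b"] uminus_C by simp

lemma power_C: "a \<in> C \<Longrightarrow> a ^ k \<in> C"
  by (induction k) (auto intro: one_C mult_C)

lemma of_nat_C: "of_nat k \<in> C"
  by (induction k) (auto intro: zero_C one_C add_C)

lemma sum_C: "(\<And>i. i \<in> A \<Longrightarrow> g i \<in> C) \<Longrightarrow> sum g A \<in> C"
  by (induction A rule: infinite_finite_induct) (auto intro: zero_C add_C)

lemmas closed = zero_C one_C add_C diff_C mult_C uminus_C power_C of_nat_C

definition unit :: "'a \<Rightarrow> bool" where "unit u \<longleftrightarrow> u \<in> C \<and> (\<exists>v\<in>C. u * v = 1)"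

lemma unit_C: "unit u \<Longrightarrow> u \<in> C" by (simp add: unit_def)

lemma unit_mult: "unit u \<Longrightarrow> unit v \<Longrightarrow> unit (u * v)"
  unfolding unit_def by (metis mult.assoc mult.left_commute mult_1_right mult_C)

lemma unit_uminus: "unit u \<Longrightarrow> unit (- u)"
  unfolding unit_def by (metis minus_mult_minus uminus_C)

lemma unit_inverse: "unit u \<Longrightarrow> \<exists>v. unit v \<and> u * v = 1"
  unfolding unit_def by (metis mult.commute)

lemma cancel_unit: "n * v = 1 \<Longrightarrow> n * x = z \<Longrightarrow> x = v * (z::'a)"
  by (auto simp: mult.assoc[symmetric] mult.commute)

definition ideal_in :: "'a set \<Rightarrow> bool" where
  "ideal_in K \<longleftrightarrow> K \<subseteq> C \<and> 0 \<in> K \<and> (\<forall>a\<in>K. \<forall>b\<in>K. a + b \<in> K) \<and> (\<forall>c\<in>C. \<forall>a\<in>K. c * a \<in> K)"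

lemma ideal_inI:
  assumes "\<And>a. a \<in> N \<Longrightarrow> a \<in> C" "0 \<in> N" "\<And>a b. a \<in> N \<Longrightarrow> b \<in> N \<Longrightarrow> a + b \<in> N"
    "\<And>c a. c \<in> C \<Longrightarrow> a \<in> N \<Longrightarrow> c * a \<in> N"
  shows "ideal_in N"
  using assms unfolding ideal_in_def by blast

context
  fixes N
  assumes N: "ideal_in N"
begin

lemma ideal_C: "a \<in> N \<Longrightarrow> a \<in> C" and ideal_0: "0 \<in> N"
  and ideal_add: "a \<in> N \<Longrightarrow> b \<in> N \<Longrightarrow> a + b \<in> N"
  and ideal_mult: "c \<in> C \<Longrightarrow> a \<in> N \<Longrightarrow> c * a \<in> N"
  using N unfolding ideal_in_def by blast+

lemma ideal_mult': "c \<in> C \<Longrightarrow> a \<in> N \<Longrightarrow> a * c \<in> N"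
  by (subst mult.commute) (rule ideal_mult)

lemma ideal_uminus: "a \<in> N \<Longrightarrow> - a \<in> N"
  using ideal_mult[of "- 1" a] by (simp add: closed)

lemma ideal_diff: "a \<in> N \<Longrightarrow> b \<in> N \<Longrightarrow> a - b \<in> N"
  using ideal_add[of a "- b"] ideal_uminus by simp

lemma ideal_sum: "(\<And>i. i \<in> A \<Longrightarrow> g i \<in> N) \<Longrightarrow> sum g A \<in> N"
  by (induction A rule: infinite_finite_induct) (auto intro: ideal_0 ideal_add)

lemma ideal_unit: "unit u \<Longrightarrow> u * a \<in> N \<Longrightarrow> a \<in> N"
  using unit_inverse[of u] cancel_unit[of u _ a] ideal_mult unit_C by metis

end

lemmas ideal_closed = ideal_0 ideal_add ideal_mult ideal_mult' ideal_uminus ideal_diff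

definition colon :: "'a set \<Rightarrow> 'a \<Rightarrow> 'a set" where "colon K x = {h \<in> C. h * x \<in> K}"

lemma ideal_colon: "ideal_in N \<Longrightarrow> x \<in> C \<Longrightarrow> ideal_in (colon N x)"
  by (rule ideal_inI)
    (auto simp: colon_def closed ideal_0 distrib_right mult.assoc intro: ideal_add ideal_mult)

definition prime_in :: "'a set \<Rightarrow> bool" where
  "prime_in p \<longleftrightarrow> 1 \<notin> p \<and> (\<forall>a\<in>C. \<forall>b\<in>C. a * b \<in> p \<longrightarrow> a \<in> p \<or> b \<in> p)"

lemma prime_inD: "prime_in p \<Longrightarrow> a \<in> C \<Longrightarrow> b \<in> C \<Longrightarrow> a * b \<in> p \<Longrightarrow> a \<in> p \<or> b \<in> p"
  and prime_in_1: "prime_in p \<Longrightarrow> 1 \<notin> p"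
  by (auto simp: prime_in_def)

lemma prime_in_power: "prime_in p \<Longrightarrow> a \<in> C \<Longrightarrow> a ^ i \<in> p \<Longrightarrow> a \<in> p"
proof (induction i)
  case (Suc i)
  then show ?case using prime_inD[of p a "a ^ i"] by (auto simp: closed)
qed (simp add: prime_in_1)

definition vars_ideal :: "(nat \<Rightarrow> 'a) \<Rightarrow> nat \<Rightarrow> 'a set" where
  "vars_ideal y k = {\<Sum>i<k. y i * r i | r. \<forall>i<k. r i \<in> C}"

lemma ideal_vars_ideal:
  assumes y_C: "\<And>i. i < k \<Longrightarrow> y i \<in> C"
  shows "ideal_in (vars_ideal y k)"
proof (rule ideal_inI)
  show "0 \<in> vars_ideal y k" by (auto simp: vars_ideal_def intro!: exI[of _ "\<lambda>_. 0"] closed)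
  fix a assume "a \<in> vars_ideal y k"
  then obtain r where r: "\<forall>i<k. r i \<in> C" "a = (\<Sum>i<k. y i * r i)" by (auto simp: vars_ideal_def)
  then show "a \<in> C" by (auto intro!: sum_C closed y_C)
  show "c * a \<in> vars_ideal y k" if "c \<in> C" for c
  proof -
    have "c * a = (\<Sum>i<k. y i * (c * r i))"
      unfolding r(2) sum_distrib_left by (simp add: mult.left_commute)
    moreover have "\<forall>i<k. c * r i \<in> C" using r that mult_C by blast
    ultimately show ?thesis
      unfolding vars_ideal_def by (intro CollectI exI[of _ "\<lambda>i. c * r i"]) simp
  qed
  fix b assume "b \<in> vars_ideal y k"
  then obtain s where s: "\<forall>i<k. s i \<in> C" "b = (\<Sum>i<k. y i * s i)" by (auto simp: vars_ideal_def)
  then have "a + b = (\<Sum>i<k. y i * (r i + s i))"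
    unfolding r(2) by (simp add: distrib_left sum.distrib)
  moreover have "\<forall>i<k. r i + s i \<in> C" using r s add_C by blast
  ultimately show "a + b \<in> vars_ideal y k"
    unfolding vars_ideal_def by (intro CollectI exI[of _ "\<lambda>i. r i + s i"]) simp
qed

lemma vars_ideal_0: "vars_ideal y 0 = {0}" by (auto simp: vars_ideal_def)

lemma vars_ideal_Suc: "a \<in> vars_ideal y (Suc k) \<longleftrightarrow> (\<exists>v\<in>vars_ideal y k. \<exists>z\<in>C. a = v + y k * z)"
proof
  assume "a \<in> vars_ideal y (Suc k)"
  then obtain r where "\<forall>i<Suc k. r i \<in> C" "a = (\<Sum>i<k. y i * r i) + y k * r k"
    by (auto simp: vars_ideal_def)
  moreover from this have "(\<Sum>i<k. y i * r i) \<in> vars_ideal y k" by (auto simp: vars_ideal_def)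
  ultimately show "\<exists>v\<in>vars_ideal y k. \<exists>z\<in>C. a = v + y k * z" by blast
next
  assume "\<exists>v\<in>vars_ideal y k. \<exists>z\<in>C. a = v + y k * z"
  then obtain r z where "\<forall>i<k. r i \<in> C" "z \<in> C" "a = (\<Sum>i<k. y i * r i) + y k * z"
    by (auto simp: vars_ideal_def)
  then show "a \<in> vars_ideal y (Suc k)"
    by (auto simp: vars_ideal_def less_Suc_eq intro!: exI[of _ "r(k := z)"])
qed

lemma vars_ideal_Suc_mono: "a \<in> vars_ideal y k \<Longrightarrow> a \<in> vars_ideal y (Suc k)"
  unfolding vars_ideal_Suc by (metis add.right_neutral mult_zero_right zero_C)

lemma power_cancel_vars_ideal:
  assumes "prime_in (vars_ideal y k)" "y k \<in> C" "y k \<notin> vars_ideal y k"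
    and "z \<in> C" "y k ^ i * z \<in> vars_ideal y k"
  shows "z \<in> vars_ideal y k"
  using prime_inD[OF assms(1), of "y k ^ i" z] prime_in_power[OF assms(1), of "y k" i] assms
  by (auto simp: closed)

text \<open>
  The element \<open>x\<close> itself lies in the larger prime, \<open>x = w + y\<^sub>k z\<close>, and \<open>y\<^sub>k\<close> can be cancelled modulo the
  smaller prime, which leaves the same situation for \<open>z\<close> and \<open>i - 1\<close>. So the ideal
  \<open>(y\<^sub>0, \<dots>, y\<^sub>k\<^sub>-\<^sub>1, y\<^sub>k\<^sup>i)\<close>, if \<open>i > 0\<close>, is \<open>(y\<^sub>0, \<dots>, y\<^sub>k)\<close>-primary.
\<close>

lemma power_primary:
  assumes y_C: "\<And>i. i \<le> k \<Longrightarrow> y i \<in> C"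
    and prime: "prime_in (vars_ideal y k)" "prime_in (vars_ideal y (Suc k))"
    and notin: "y k \<notin> vars_ideal y k"
    and h: "h \<in> C" "h \<notin> vars_ideal y (Suc k)"
    and "x \<in> C" "v \<in> vars_ideal y k" "s \<in> C" "h * x = v + y k ^ i * s"
  shows "\<exists>v\<in>vars_ideal y k. \<exists>s\<in>C. x = v + y k ^ i * s"
proof -
  have V: "ideal_in (vars_ideal y k)" by (rule ideal_vars_ideal) (simp add: y_C)
  show ?thesis
    using assms(7-)
  proof (induction i arbitrary: x v s)
    case 0
    then show ?case by (intro bexI[of _ 0] bexI[of _ x]) (auto intro: ideal_0[OF V])
  next
    case (Suc i)
    have "h * x = v + y k * (y k ^ i * s)" using Suc.prems by (simp add: mult.assoc)
    then have "h * x \<in> vars_ideal y (Suc k)"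
      unfolding vars_ideal_Suc using Suc.prems(2,3)
      by (intro bexI[of _ v] bexI[of _ "y k ^ i * s"]) (simp_all add: closed y_C)
    then have "x \<in> vars_ideal y (Suc k)"
      using prime_inD[OF prime(2), of h x] h Suc.prems(1) by auto
    then obtain w z where x: "w \<in> vars_ideal y k" "z \<in> C" "x = w + y k * z" by (auto simp: vars_ideal_Suc)
    have "y k ^ 1 * (h * z - y k ^ i * s) = v - h * w"
      using Suc.prems x by (simp add: algebra_simps)
    moreover have "v - h * w \<in> vars_ideal y k"
      using Suc.prems x h by (intro ideal_closed[OF V])
    ultimately have *: "h * z - y k ^ i * s \<in> vars_ideal y k"
      using power_cancel_vars_ideal[OF prime(1) y_C notin, of "h * z - y k ^ i * s" 1] h Suc.prems x
      by (simp add: closed y_C)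
    obtain v' s' where z: "v' \<in> vars_ideal y k" "s' \<in> C" "z = v' + y k ^ i * s'"
      using Suc.IH[OF x(2) * Suc.prems(3)] by auto
    have "x = (w + y k * v') + y k ^ Suc i * s'" using x z by (simp add: algebra_simps)
    moreover have "w + y k * v' \<in> vars_ideal y k" using x z by (intro ideal_closed[OF V] closed y_C) simp_all
    ultimately show ?case using z by blast
  qed
qed

end

section \<open>The ideals generated by the coefficients of the inverse square\<close>

text \<open>
  The facts about the partial derivatives that determine the associated primes: the primality of the
  ideals generated by the first few variables, and the recurrence of the coefficients \<open>G\<^sub>m\<close> of
  \<open>1 / Y\<^sup>2\<close>. Nonzero integers have to be invertible because the recurrence is solved for \<open>G\<^sub>m\<close>, and later for
  \<open>y\<^sub>1 G\<^sub>m\<^sub>-\<^sub>1\<close>.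
\<close>

locale sub_Hankel_core = unital_subring C for C :: "'a::idom set" +
  fixes y :: "nat \<Rightarrow> 'a" and G :: "nat \<Rightarrow> 'a"
  assumes y_C: "y k \<in> C"
    and of_nat_unit: "m \<noteq> 0 \<Longrightarrow> unit (of_nat m)"
    and prime_vars: "k \<le> 3 \<Longrightarrow> prime_in (vars_ideal y k)"
    and y_notin_vars: "k < 3 \<Longrightarrow> y k \<notin> vars_ideal y k"
    and G_0: "G 0 = 1"
    and G_rec: "of_nat m * G m = - (\<Sum>k=1..m. of_nat (m + k) * y k * y 0 ^ (k - 1) * G (m - k))"
begin

lemma G_C: "G m \<in> C"
proof (induction m rule: less_induct)
  case (less m)
  show ?case
  proof (cases "m = 0")
    case False
    then obtain v where v: "v \<in> C" "of_nat m * v = 1" using of_nat_unit unit_def by blast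
    have "G m = v * (of_nat m * G m)" using v by (simp add: mult.assoc[symmetric] mult.commute)
    also have "\<dots> \<in> C"
      unfolding G_rec using less
      by (intro mult_C uminus_C sum_C of_nat_C y_C power_C v) auto
    finally show ?thesis .
  qed (simp add: G_0 one_C)
qed

lemmas closed = closed y_C G_C

text \<open>
  The ideal generated by \<open>G\<^sub>m\<^sub>-\<^sub>1, y\<^sub>0 G\<^sub>m\<^sub>-\<^sub>2, \<dots>, y\<^sub>0\<^bsup>m-1\<^esup> G\<^sub>0\<close>; for \<open>m = n\<close> these are, up to sign, the
  partial derivatives of \<open>f\<close> by \<open>y\<^sub>1, \<dots>, y\<^sub>n\<close>. The recursive form makes division by \<open>y\<^sub>0\<close> visible.
\<close>

primrec I :: "nat \<Rightarrow> 'a set" where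
  "I 0 = {0}"
| "I (Suc m) = {y 0 * a + b * G m | a b. a \<in> I m \<and> b \<in> C}"

lemma I_subset_C: "a \<in> I m \<Longrightarrow> a \<in> C"
  by (induction m arbitrary: a) (auto simp: closed)

lemma I_SucI: "a \<in> I m \<Longrightarrow> b \<in> C \<Longrightarrow> y 0 * a + b * G m \<in> I (Suc m)"
  by auto

lemma I_SucE:
  assumes "p \<in> I (Suc m)"
  obtains a b where "a \<in> I m" "b \<in> C" "p = y 0 * a + b * G m"
  using assms by auto

declare I.simps(2) [simp del]

lemma I_zero: "0 \<in> I m"
proof (induction m)
  case (Suc m)
  from I_SucI[OF this zero_C] show ?case by simp
qed simp

lemma I_add: "a \<in> I m \<Longrightarrow> b \<in> I m \<Longrightarrow> a + b \<in> I m"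
proof (induction m arbitrary: a b)
  case (Suc m)
  from Suc.prems obtain a1 c1 a2 c2 where
    *: "a = y 0 * a1 + c1 * G m" "b = y 0 * a2 + c2 * G m" "a1 \<in> I m" "a2 \<in> I m" "c1 \<in> C" "c2 \<in> C"
    by (elim I_SucE)
  then have "a + b = y 0 * (a1 + a2) + (c1 + c2) * G m" by (simp add: algebra_simps)
  then show ?case using * by (simp add: I_SucI Suc.IH closed)
qed simp

lemma I_mult: "c \<in> C \<Longrightarrow> a \<in> I m \<Longrightarrow> c * a \<in> I m"
proof (induction m arbitrary: a)
  case (Suc m)
  from Suc.prems obtain a1 c1 where *: "a = y 0 * a1 + c1 * G m" "a1 \<in> I m" "c1 \<in> C"
    by (elim I_SucE)
  then have "c * a = y 0 * (c * a1) + (c * c1) * G m" by (simp add: algebra_simps)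
  then show ?case using * Suc by (simp add: I_SucI closed)
qed simp

lemma ideal_I: "ideal_in (I m)"
  by (intro ideal_inI) (auto intro: I_subset_C I_zero I_add I_mult)

lemmas I_uminus = ideal_uminus[OF ideal_I]
  and I_diff = ideal_diff[OF ideal_I]
  and I_sum = ideal_sum[OF ideal_I]

lemma y0_I: "a \<in> I m \<Longrightarrow> y 0 * a \<in> I (Suc m)"
  using I_SucI[of a m 0] by (simp add: closed)

lemma G_I: "G m \<in> I (Suc m)"
  using I_SucI[of 0 m 1] by (simp add: closed I_zero)

lemma y0_power_G_in_I_Suc: "y 0 ^ k * G j \<in> I (Suc (j + k))"
proof (induction k)
  case (Suc k)
  from y0_I[OF this] show ?case by (simp add: mult.assoc)
qed (use G_I in simp)

lemma y0_power_G_in_I: "k < m \<Longrightarrow> y 0 ^ k * G (m - Suc k) \<in> I m"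
  using y0_power_G_in_I_Suc[of k "m - Suc k"] by simp

text \<open>
  By the recurrence, \<open>m G\<^sub>m\<close> is a combination of the generators of \<open>I\<^sub>m\<close>. Consequently \<open>I\<^sub>m\<^sub>+\<^sub>1\<close> is contained in
  \<open>I\<^sub>m\<close>, although \<open>G\<^sub>m\<close> is one of its generators.
\<close>

lemma G_in_I: assumes "m \<noteq> 0" shows "G m \<in> I m"
proof -
  obtain v where v: "v \<in> C" "of_nat m * v = 1" using of_nat_unit assms unit_def by blast
  have eq: "G m = v * (of_nat m * G m)" using v by (simp add: mult.assoc[symmetric] mult.commute)
  have "of_nat m * G m \<in> I m"
    unfolding G_rec
  proof (intro I_uminus I_sum)
    fix k assume "k \<in> {1..m}"
    then have "y 0 ^ (k - 1) * G (m - k) \<in> I m"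
      using y0_power_G_in_I[of "k - 1" m] by (cases k) auto
    then show "of_nat (m + k) * y k * y 0 ^ (k - 1) * G (m - k) \<in> I m"
      using I_mult[of "of_nat (m + k) * y k"] by (simp add: mult.assoc closed)
  qed
  from I_mult[OF v(1) this] show ?thesis using eq by simp
qed

text \<open>
  The recurrence for \<open>G\<^sub>j\<^sub>+\<^sub>1\<close>, solved for the term with \<open>y\<^sub>1\<close>; the terms with \<open>y\<^sub>2, y\<^sub>3, \<dots>\<close> are
  \<open>y\<^sub>0\<close> times generators of \<open>I\<^sub>j\<close>.
\<close>

lemma y1_mult_G: "\<exists>u s. unit u \<and> s \<in> I j \<and> y 1 * G j = u * G (Suc j) + y 0 * s"
proof -
  obtain v where v: "unit v" "of_nat (j + 2) * v = 1"
    using unit_inverse[OF of_nat_unit[of "j + 2"]] by auto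
  define S where "S = (\<Sum>k=2..Suc j. of_nat (Suc j + k) * y k * y 0 ^ (k - 2) * G (Suc j - k))"
  have S: "S \<in> I j"
    unfolding S_def
  proof (intro I_sum)
    fix k assume "k \<in> {2..Suc j}"
    then obtain l where "k = l + 2" "l < j" by (auto simp: less_eq_Suc_le dest!: le_Suc_ex)
    then have "y 0 ^ (k - 2) * G (Suc j - k) \<in> I j"
      using y0_power_G_in_I[of l j] by simp
    then show "of_nat (Suc j + k) * y k * y 0 ^ (k - 2) * G (Suc j - k) \<in> I j"
      using I_mult[of "of_nat (Suc j + k) * y k"] by (simp only: mult.assoc closed)
  qed
  have "(\<Sum>k=2..Suc j. of_nat (Suc j + k) * y k * y 0 ^ (k - 1) * G (Suc j - k)) = y 0 * S"
    unfolding S_def sum_distrib_left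
  proof (intro sum.cong refl)
    fix k assume "k \<in> {2..Suc j}"
    then obtain l where "k = l + 2" by (metis add.commute atLeastAtMost_iff le_Suc_ex)
    then show "of_nat (Suc j + k) * y k * y 0 ^ (k - 1) * G (Suc j - k)
      = y 0 * (of_nat (Suc j + k) * y k * y 0 ^ (k - 2) * G (Suc j - k))"
      by (simp add: algebra_simps)
  qed
  then have "of_nat (Suc j) * G (Suc j) = - (of_nat (j + 2) * y 1 * G j + y 0 * S)"
    unfolding G_rec by (subst sum.atLeast_Suc_atMost) (auto simp: numeral_2_eq_2)
  then have "of_nat (j + 2) * (y 1 * G j) = - (of_nat (Suc j) * G (Suc j)) - y 0 * S"
    by (simp add: mult.assoc)
  from cancel_unit[OF v(2) this] have "y 1 * G j = - (v * of_nat (Suc j)) * G (Suc j) + y 0 * (- v * S)"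
    by (simp only: right_diff_distrib distrib_left mult_minus_left mult_minus_right
        diff_conv_add_uminus ac_simps)
  moreover have "unit (- (v * of_nat (Suc j)))"
    by (intro unit_uminus unit_mult v of_nat_unit) simp
  moreover have "- v * S \<in> I j" by (intro I_mult S uminus_C unit_C v)
  ultimately show ?thesis by blast
qed

text \<open>
  The same one index higher, with the term of \<open>y\<^sub>2\<close> kept apart. Its coefficient is a unit; this is what
  produces exactly one more factor \<open>y\<^sub>2\<close> with each division by \<open>y\<^sub>0\<close>.
\<close>

lemma y1_mult_G_Suc: "\<exists>c u s. c \<in> C \<and> unit u \<and> s \<in> I j \<and>
  y 1 * G (Suc j) = c * G (j + 2) + y 0 * (u * y 2 * G j) + y 0 * (y 0 * s)"
proof -
  obtain v where v: "unit v" "of_nat (j + 3) * v = 1"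
    using unit_inverse[OF of_nat_unit[of "j + 3"]] by auto
  define S where "S = (\<Sum>k=3..j+2. of_nat (j + 2 + k) * y k * y 0 ^ (k - 3) * G (j + 2 - k))"
  have S: "S \<in> I j"
    unfolding S_def
  proof (intro I_sum)
    fix k assume "k \<in> {3..j+2}"
    then obtain l where "k = l + 3" "l < j" by (auto simp: less_eq_Suc_le dest!: le_Suc_ex)
    then have "y 0 ^ (k - 3) * G (j + 2 - k) \<in> I j"
      using y0_power_G_in_I[of l j] by (simp add: numeral_eq_Suc)
    then show "of_nat (j + 2 + k) * y k * y 0 ^ (k - 3) * G (j + 2 - k) \<in> I j"
      using I_mult[of "of_nat (j + 2 + k) * y k"] by (simp only: mult.assoc closed)
  qed
  define g where "g k = of_nat (j + 2 + k) * y k * y 0 ^ (k - 1) * G (j + 2 - k)" for k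
  have g1: "g 1 = of_nat (j + 3) * y 1 * G (Suc j)" and g2: "g 2 = of_nat (j + 4) * y 2 * y 0 * G j"
    by (simp_all add: g_def numeral_eq_Suc del: of_nat_Suc of_nat_add)
  have tail: "sum g {3..j+2} = y 0 * (y 0 * S)"
    unfolding S_def sum_distrib_left
  proof (intro sum.cong refl)
    fix k assume "k \<in> {3..j+2}"
    then obtain l where "k = l + 3" by (metis add.commute atLeastAtMost_iff le_Suc_ex)
    then show "g k = y 0 * (y 0 * (of_nat (j + 2 + k) * y k * y 0 ^ (k - 3) * G (j + 2 - k)))"
      by (simp add: algebra_simps power_add g_def)
  qed
  have "{1..j+2} = insert 1 (insert 2 {3..j+2})" by auto
  then have "sum g {1..j+2} = g 1 + (g 2 + sum g {3..j+2})" by simp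
  moreover have "of_nat (j + 2) * G (j + 2) = - sum g {1..j+2}"
    unfolding G_rec g_def ..
  ultimately have "of_nat (j + 2) * G (j + 2) =
     - (of_nat (j + 3) * y 1 * G (Suc j) + (of_nat (j + 4) * y 2 * y 0 * G j + y 0 * (y 0 * S)))"
    unfolding g1 g2 tail by simp
  then have "of_nat (j + 3) * (y 1 * G (Suc j)) =
      - (of_nat (j + 2) * G (j + 2)) - (of_nat (j + 4) * y 2 * y 0 * G j + y 0 * (y 0 * S))"
    by (simp add: mult.assoc)
  from cancel_unit[OF v(2) this]
  have "y 1 * G (Suc j) = (- (v * of_nat (j + 2))) * G (j + 2)
      + y 0 * ((- (v * of_nat (j + 4))) * y 2 * G j) + y 0 * (y 0 * (- v * S))"
    by (simp only: right_diff_distrib distrib_left mult_minus_left mult_minus_right diff_conv_add_uminus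
        minus_add_distrib ac_simps)
  moreover have "unit (- (v * of_nat (j + 4)))"
    by (intro unit_uminus unit_mult v of_nat_unit) simp
  moreover have "- (v * of_nat (j + 2)) \<in> C" by (intro closed unit_C v)
  moreover have "- v * S \<in> I j" by (intro I_mult S uminus_C unit_C v)
  ultimately show ?thesis by blast
qed

text \<open>
  Modulo \<open>y\<^sub>0\<close> the recurrence is \<open>m G\<^sub>m = - (m + 1) y\<^sub>1 G\<^sub>m\<^sub>-\<^sub>1\<close>.
\<close>

lemma G_mod_y0: "\<exists>u d. unit u \<and> d \<in> C \<and> G m = u * y 1 ^ m + y 0 * d"
proof (induction m)
  case 0
  show ?case by (intro exI[of _ 1] exI[of _ 0]) (auto simp: G_0 unit_def closed)
next
  case (Suc m)
  then obtain u d where ud: "unit u" "d \<in> C" "G m = u * y 1 ^ m + y 0 * d" by blast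
  obtain w s where w: "unit w" "s \<in> I m" "y 1 * G m = w * G (Suc m) + y 0 * s"
    using y1_mult_G by blast
  obtain v where v: "unit v" "w * v = 1" using unit_inverse w by blast
  have "w * G (Suc m) = y 1 * G m - y 0 * s" using w by simp
  from cancel_unit[OF v(2) this] have "G (Suc m) = v * (y 1 * G m - y 0 * s)" .
  also have "\<dots> = (v * u) * y 1 ^ Suc m + y 0 * (v * y 1 * d - v * s)"
    unfolding ud by (simp add: algebra_simps)
  finally have "G (Suc m) = (v * u) * y 1 ^ Suc m + y 0 * (v * y 1 * d - v * s)" .
  moreover have "unit (v * u)" using v ud by (simp add: unit_mult)
  moreover have "v * y 1 * d - v * s \<in> C" using ud v w by (simp add: closed unit_C I_subset_C)
  ultimately show ?case by blast
qed

text \<open>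
  Multiplication by \<open>y\<^sub>1\<close> raises the index of each generator by one, up to multiples of \<open>y\<^sub>0\<close>; it controls
  the remainder of \<open>E\<close> in the passage from \<open>E\<close> to \<open>y\<^sub>1 E\<close>.
\<close>

lemma y1_mult_I: "a \<in> I (Suc j) \<Longrightarrow> \<exists>p q. p \<in> I (j + 2) \<and> q \<in> I j \<and> y 1 * a = p + y 0 * q"
proof (induction j arbitrary: a)
  case 0
  then obtain b where b: "b \<in> C" "a = b * G 0" by (elim I_SucE) auto
  obtain u s where u: "unit u" "s \<in> I 0" "y 1 * G 0 = u * G (Suc 0) + y 0 * s"
    using y1_mult_G by blast
  have "y 1 * a = (b * u) * G 1 + y 0 * 0" using b u by (simp add: algebra_simps)
  moreover have "(b * u) * G 1 \<in> I (0 + 2)"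
    using b u G_I[of 1] by (simp add: I_mult closed unit_C numeral_2_eq_2)
  ultimately show ?case using I_zero by blast
next
  case (Suc j)
  obtain a1 b where b: "a1 \<in> I (Suc j)" "b \<in> C" "a = y 0 * a1 + b * G (Suc j)"
    using I_SucE[OF Suc.prems] by blast
  obtain u s where u: "unit u" "s \<in> I (Suc j)"
    "y 1 * G (Suc j) = u * G (Suc (Suc j)) + y 0 * s"
    using y1_mult_G by blast
  from Suc.IH[OF b(1)] obtain p q where pq: "p \<in> I (j + 2)" "q \<in> I j" "y 1 * a1 = p + y 0 * q"
    by blast
  have "y 1 * a = (y 0 * p + (b * u) * G (j + 2)) + y 0 * (b * s + y 0 * q)"
  proof -
    have "y 1 * a = y 0 * (y 1 * a1) + b * (y 1 * G (Suc j))"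
      using b by (simp add: algebra_simps)
    also have "\<dots> = (y 0 * p + (b * u) * G (j + 2)) + y 0 * (b * s + y 0 * q)"
      unfolding u pq by (simp add: algebra_simps)
    finally show ?thesis .
  qed
  moreover have "y 0 * p + (b * u) * G (j + 2) \<in> I (Suc j + 2)"
    using b u pq G_I[of "j + 2"] y0_I[of p "j + 2"]
    by (simp add: I_add I_mult closed unit_C numeral_2_eq_2)
  moreover have "b * s + y 0 * q \<in> I (Suc j)"
    using b u pq by (intro I_add I_mult y0_I)
  ultimately show ?case by blast
qed

text \<open>
  The factor \<open>y\<^sub>0\<^sup>l\<close> is there for the induction: the generators of \<open>I\<^sub>m\<close> occur in \<open>I\<^sub>m\<^sub>+\<^sub>1\<close> multiplied by
  \<open>y\<^sub>0\<close>.
\<close>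

lemma I_least:
  assumes N: "ideal_in N" and gen: "\<And>k. k < m \<Longrightarrow> y 0 ^ (l + k) * G (m - Suc k) \<in> N"
    and "a \<in> I m"
  shows "y 0 ^ l * a \<in> N"
  using gen \<open>a \<in> I m\<close>
proof (induction m arbitrary: l a)
  case 0
  then show ?case using ideal_0[OF N] by simp
next
  case (Suc m)
  obtain b c where b: "b \<in> I m" "c \<in> C" "a = y 0 * b + c * G m"
    using I_SucE[OF Suc.prems(2)] by blast
  have "y 0 ^ Suc l * b \<in> N"
    using Suc.IH[of "Suc l" b] Suc.prems(1)[of "Suc _"] b by simp
  moreover have "c * (y 0 ^ l * G m) \<in> N"
    using ideal_mult[OF N b(2), of "y 0 ^ l * G m"] Suc.prems(1)[of 0] by simp
  moreover have "y 0 ^ l * a = y 0 ^ Suc l * b + c * (y 0 ^ l * G m)"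
    using b by (simp add: algebra_simps)
  ultimately show ?case using ideal_add[OF N] by simp
qed

abbreviation V :: "nat \<Rightarrow> 'a set" where "V \<equiv> vars_ideal y"

lemma ideal_V: "ideal_in (V k)"
  by (rule ideal_vars_ideal) (rule y_C)

lemmas V_Suc_mono = vars_ideal_Suc_mono[where y = y]

text \<open>
  The second equivalence is the first one in the normal form of the simplifier.
\<close>

lemma V_1: "a \<in> V 1 \<longleftrightarrow> (\<exists>r\<in>C. a = y 0 * r)" "a \<in> V (Suc 0) \<longleftrightarrow> (\<exists>r\<in>C. a = y 0 * r)"
  unfolding One_nat_def vars_ideal_Suc vars_ideal_0 by simp_all

lemma y0_V_1: "c \<in> C \<Longrightarrow> y 0 * c \<in> V 1" "c \<in> C \<Longrightarrow> y 0 * c \<in> V (Suc 0)"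
  unfolding V_1 by auto

lemma V_chain: "a \<in> V 1 \<Longrightarrow> a \<in> V 2" "a \<in> V 2 \<Longrightarrow> a \<in> V 3"
  using V_Suc_mono[of a 1] V_Suc_mono[of a 2] by (simp_all add: numeral_eq_Suc)

lemma V_2: "a \<in> V 2 \<longleftrightarrow> (\<exists>v\<in>V 1. \<exists>z\<in>C. a = v + y 1 * z)"
  and V_3: "a \<in> V 3 \<longleftrightarrow> (\<exists>v\<in>V 2. \<exists>z\<in>C. a = v + y 2 * z)"
  using vars_ideal_Suc[of a y 1] vars_ideal_Suc[of a y 2] by (simp_all add: numeral_eq_Suc)

lemma V_2_subset:
  assumes "ideal_in p" "y 0 \<in> p" "y 1 \<in> p" shows "V 2 \<subseteq> p"
  using assms by (auto simp: V_2 V_1 intro!: ideal_add ideal_mult')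

lemma V_3_subset:
  assumes "ideal_in p" "y 0 \<in> p" "y 1 \<in> p" "y 2 \<in> p" shows "V 3 \<subseteq> p"
  using V_2_subset[of p] assms by (auto simp: V_3 intro!: ideal_add ideal_mult')

lemma V_cancel: "k < 3 \<Longrightarrow> z \<in> C \<Longrightarrow> y k ^ i * z \<in> V k \<Longrightarrow> z \<in> V k"
  using power_cancel_vars_ideal[OF prime_vars y_C y_notin_vars] by simp

lemma V_primary:
  assumes "k < 3" "h \<in> C" "h \<notin> V (Suc k)"
    and "x \<in> C" "v \<in> V k" "s \<in> C" "h * x = v + y k ^ i * s"
  shows "\<exists>v\<in>V k. \<exists>s\<in>C. x = v + y k ^ i * s"
  using power_primary[OF y_C prime_vars prime_vars y_notin_vars] assms by simp

section \<open>The monomial ideals modulo the first variable\<close>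

text \<open>
  The ideal \<open>(y\<^sub>0, y\<^sub>1\<^bsup>j+1\<^esup>, y\<^sub>1\<^sup>j y\<^sub>2\<^sup>a)\<close>. For positive \<open>j\<close> and \<open>a\<close> it is the intersection of the
  \<open>P\<close>-primary ideal \<open>(y\<^sub>0, y\<^sub>1\<^sup>j)\<close> and the \<open>Q\<close>-primary ideal \<open>(y\<^sub>0, y\<^sub>1\<^bsup>j+1\<^esup>, y\<^sub>2\<^sup>a)\<close>.
\<close>

definition monomial_ideal :: "nat \<Rightarrow> nat \<Rightarrow> 'a set" where
  "monomial_ideal j a = {v + y 1 ^ Suc j * s + y 1 ^ j * y 2 ^ a * t | v s t. v \<in> V 1 \<and> s \<in> C \<and> t \<in> C}"

lemma monomial_idealI: "v \<in> V 1 \<Longrightarrow> s \<in> C \<Longrightarrow> t \<in> C \<Longrightarrow>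
    z = v + y 1 ^ Suc j * s + y 1 ^ j * y 2 ^ a * t \<Longrightarrow> z \<in> monomial_ideal j a"
  unfolding monomial_ideal_def by blast

lemma monomial_idealE:
  assumes "z \<in> monomial_ideal j a"
  obtains v s t where "v \<in> V 1" "s \<in> C" "t \<in> C" "z = v + y 1 ^ Suc j * s + y 1 ^ j * y 2 ^ a * t"
  using assms unfolding monomial_ideal_def by blast

lemma ideal_monomial_ideal: "ideal_in (monomial_ideal j a)"
proof (rule ideal_inI)
  show "0 \<in> monomial_ideal j a" by (rule monomial_idealI[of 0 0 0]) (simp_all add: closed ideal_0[OF ideal_V])
  fix p assume p: "p \<in> monomial_ideal j a"
  show "p \<in> C" using p by (rule monomial_idealE) (simp add: closed ideal_C[OF ideal_V])
  show "c * p \<in> monomial_ideal j a" if "c \<in> C" for c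
    using p
  proof (rule monomial_idealE)
    fix v s t assume "v \<in> V 1" "s \<in> C" "t \<in> C" "p = v + y 1 ^ Suc j * s + y 1 ^ j * y 2 ^ a * t"
    then show ?thesis using that
      by (intro monomial_idealI[of "c * v" "c * s" "c * t"])
        (simp_all add: closed ideal_mult[OF ideal_V] algebra_simps)
  qed
  fix q assume q: "q \<in> monomial_ideal j a"
  obtain v s t where "v \<in> V 1" "s \<in> C" "t \<in> C" "p = v + y 1 ^ Suc j * s + y 1 ^ j * y 2 ^ a * t"
    using p by (rule monomial_idealE)
  moreover obtain v' s' t' where "v' \<in> V 1" "s' \<in> C" "t' \<in> C"
      "q = v' + y 1 ^ Suc j * s' + y 1 ^ j * y 2 ^ a * t'"
    using q by (rule monomial_idealE)
  ultimately show "p + q \<in> monomial_ideal j a"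
    by (intro monomial_idealI[of "v + v'" "s + s'" "t + t'"])
      (simp_all add: closed ideal_add[OF ideal_V] algebra_simps)
qed

lemma y0_monomial_ideal: "c \<in> C \<Longrightarrow> y 0 * c \<in> monomial_ideal j a"
  by (rule monomial_idealI[of "y 0 * c" 0 0]) (auto simp: V_1 closed)

lemma y1_power_monomial_ideal: "y 1 ^ Suc j \<in> monomial_ideal j a"
  by (rule monomial_idealI[of 0 1 0]) (auto simp: ideal_0[OF ideal_V] closed)

lemma y1_y2_power_monomial_ideal: "y 1 ^ j * y 2 ^ a \<in> monomial_ideal j a"
  by (rule monomial_idealI[of 0 0 1]) (auto simp: ideal_0[OF ideal_V] closed)

lemma monomial_ideal_P: "z \<in> monomial_ideal j a \<Longrightarrow> \<exists>v\<in>V 1. \<exists>s\<in>C. z = v + y 1 ^ j * s"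
proof (erule monomial_idealE)
  fix v s t assume "v \<in> V 1" "s \<in> C" "t \<in> C" "z = v + y 1 ^ Suc j * s + y 1 ^ j * y 2 ^ a * t"
  then show ?thesis
    by (intro bexI[of _ v] bexI[of _ "y 1 * s + y 2 ^ a * t"]) (auto simp: algebra_simps closed)
qed

text \<open>
  All associated primes of this ideal are contained in \<open>Q\<close>. First
  \<open>power_primary\<close> for \<open>P\<close> extracts the factor \<open>y\<^sub>1\<^sup>j\<close> from \<open>x\<close>, then \<open>power_primary\<close> for \<open>Q\<close> applies to the
  cofactor.
\<close>

lemma monomial_ideal_cancel:
  assumes h: "h \<in> C" "h \<notin> V 3" and x: "x \<in> C" "h * x \<in> monomial_ideal j a"
  shows "x \<in> monomial_ideal j a"
proof -
  obtain v s t where hx: "v \<in> V 1" "s \<in> C" "t \<in> C"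
    "h * x = v + y 1 ^ Suc j * s + y 1 ^ j * y 2 ^ a * t"
    using x(2) by (rule monomial_idealE)
  have "h * x = v + y 1 ^ j * (y 1 * s + y 2 ^ a * t)" using hx by (simp add: algebra_simps)
  then obtain v' z where z: "v' \<in> V 1" "z \<in> C" "x = v' + y 1 ^ j * z"
    using V_primary[of 1 h x v "y 1 * s + y 2 ^ a * t" j] h x hx V_chain
    by (auto simp: closed numeral_eq_Suc)
  have "y 1 ^ j * (h * z - (y 1 * s + y 2 ^ a * t)) = v - h * v'"
    using hx(4) unfolding z(3) by (simp add: algebra_simps)
  also have "\<dots> \<in> V 1" using h hx z by (intro ideal_closed[OF ideal_V])
  finally have "h * z - (y 1 * s + y 2 ^ a * t) \<in> V 1"
    using V_cancel[of 1] h hx z by (simp add: closed)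
  then have "h * z - y 2 ^ a * t \<in> V 2"
    unfolding V_2 using hx by (intro bexI[of _ "h * z - (y 1 * s + y 2 ^ a * t)"] bexI[of _ s]) auto
  then obtain w t' where w: "w \<in> V 2" "t' \<in> C" "z = w + y 2 ^ a * t'"
    using V_primary[of 2 h z "h * z - y 2 ^ a * t" t a] h hx z by (auto simp: numeral_eq_Suc)
  then obtain v3 s3 where "v3 \<in> V 1" "s3 \<in> C" "w = v3 + y 1 * s3" by (auto simp: V_2)
  with w z show ?thesis
    by (intro monomial_idealI[of "v' + y 1 ^ j * v3" s3 t'])
      (auto simp: algebra_simps closed intro!: ideal_closed[OF ideal_V] closed)
qed

text \<open>
  Such a prime contains \<open>y\<^sub>0\<close> and \<open>y\<^sub>1\<close>. If it contains \<open>y\<^sub>2\<close>, then it is \<open>Q\<close>, because elements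
  outside \<open>Q\<close> act injectively. If not, an element of it outside \<open>P\<close> would force \<open>x\<close> into \<open>(y\<^sub>0, y\<^sub>1\<^sup>j)\<close>, and
  \<open>y\<^sub>2\<^sup>a\<close> would annihilate the class of \<open>x\<close>.
\<close>

lemma monomial_ideal_assoc:
  assumes p: "prime_in p" "p = colon (monomial_ideal j a) x" and x: "x \<in> C"
  shows "p = V 2 \<or> p = V 3"
proof -
  have ideal: "ideal_in p" unfolding p(2) by (intro ideal_colon ideal_monomial_ideal x)
  have "x \<notin> monomial_ideal j a" using prime_in_1[OF p(1)] p(2) by (auto simp: colon_def closed)
  have y0: "y 0 \<in> p" unfolding p(2) colon_def using x by (simp add: y0_monomial_ideal closed)
  have "y 1 ^ Suc j \<in> p"
    unfolding p(2) colon_def using x ideal_mult'[OF ideal_monomial_ideal x y1_power_monomial_ideal]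
    by (simp add: closed)
  then have y1: "y 1 \<in> p" using prime_in_power[OF p(1) y_C] by blast
  show ?thesis
  proof (cases "y 2 \<in> p")
    case True
    have "p \<subseteq> V 3"
      using monomial_ideal_cancel[of _ x j a] \<open>x \<notin> monomial_ideal j a\<close> x
      by (auto simp: p(2) colon_def)
    then show ?thesis using V_3_subset[OF ideal y0 y1 True] by blast
  next
    case False
    have "p \<subseteq> V 2"
    proof
      fix h assume "h \<in> p"
      then have h: "h \<in> C" "h * x \<in> monomial_ideal j a" by (auto simp: p(2) colon_def)
      show "h \<in> V 2"
      proof (rule ccontr)
        assume notin: "h \<notin> V 2"
        obtain v s where "v \<in> V 1" "s \<in> C" "h * x = v + y 1 ^ j * s" using monomial_ideal_P h by blast
        then obtain v' s' where v': "v' \<in> V 1" "s' \<in> C" "x = v' + y 1 ^ j * s'"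
          using V_primary[of 1 h x v s j] h x notin by (auto simp: numeral_eq_Suc)
        then have "y 2 ^ a * x \<in> monomial_ideal j a"
          by (intro monomial_idealI[of "y 2 ^ a * v'" 0 s'])
            (auto simp: algebra_simps closed intro!: ideal_closed[OF ideal_V] closed)
        then have "y 2 ^ a \<in> p" by (simp add: p(2) colon_def closed)
        then show False using prime_in_power[OF p(1) y_C] False by blast
      qed
    qed
    then show ?thesis using V_2_subset[OF ideal y0 y1] by blast
  qed
qed

section \<open>Division of the gradient ideal by the first variable\<close>

text \<open>
  The shape of the one generator that is added to \<open>I\<^sub>j\<^sub>+\<^sub>2\<close>. Only its leading part is recorded; the remainder
  \<open>F\<close> is arbitrary in \<open>I\<^sub>j\<close>, because its exact form changes with every division by \<open>y\<^sub>0\<close>.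
\<close>

definition extra_gen :: "nat \<Rightarrow> nat \<Rightarrow> 'a \<Rightarrow> bool" where
  "extra_gen j a E \<longleftrightarrow> (\<exists>u F. unit u \<and> F \<in> I j \<and> E = u * y 2 ^ a * G j + y 0 * F)"

lemma extra_gen_in_I: "extra_gen j a E \<Longrightarrow> E \<in> I (Suc j)"
  by (auto simp: extra_gen_def I_add I_mult closed unit_C y0_I G_I)

lemma extra_gen_C: "extra_gen j a E \<Longrightarrow> E \<in> C" using extra_gen_in_I I_subset_C by blast

text \<open>
  Multiplication by \<open>y\<^sub>1\<close> turns \<open>E\<close> into a multiple of \<open>G\<^sub>j\<^sub>+\<^sub>2\<close> plus a multiple of \<open>y\<^sub>0\<close>. The leading part of
  the cofactor \<open>E'\<close> of \<open>y\<^sub>0\<close> comes from the \<open>y\<^sub>2\<close>-term of the recurrence, whence the exponent of \<open>y\<^sub>2\<close>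
  rises by one.
\<close>

lemma extra_gen_step:
  assumes "extra_gen (Suc j) a E"
  shows "\<exists>E' c i. extra_gen j (Suc a) E' \<and> c \<in> C \<and> i \<in> I (j + 2) \<and>
    y 1 * E = c * y 2 ^ a * G (j + 2) + y 0 * (E' + i)"
proof -
  obtain u F where E: "unit u" "F \<in> I (Suc j)" "E = u * y 2 ^ a * G (Suc j) + y 0 * F"
    using assms by (auto simp: extra_gen_def)
  obtain c w s where w: "c \<in> C" "unit w" "s \<in> I j"
    "y 1 * G (Suc j) = c * G (j + 2) + y 0 * (w * y 2 * G j) + y 0 * (y 0 * s)"
    using y1_mult_G_Suc by blast
  obtain p q where pq: "p \<in> I (j + 2)" "q \<in> I j" "y 1 * F = p + y 0 * q"
    using y1_mult_I[OF E(2)] by blast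
  define E' where "E' = (u * w) * y 2 ^ Suc a * G j + y 0 * (u * y 2 ^ a * s + q)"
  have "u * y 2 ^ a * s + q \<in> I j"
    using E w pq by (simp add: I_add I_mult closed unit_C)
  then have "extra_gen j (Suc a) E'"
    unfolding extra_gen_def E'_def using E w by (blast intro: unit_mult)
  moreover have "y 1 * E = (u * c) * y 2 ^ a * G (j + 2) + y 0 * (E' + p)"
  proof -
    have "y 1 * E = u * y 2 ^ a * (y 1 * G (Suc j)) + y 0 * (y 1 * F)"
      unfolding E by (simp add: algebra_simps)
    also have "\<dots> = (u * c) * y 2 ^ a * G (j + 2) + y 0 * (E' + p)"
      unfolding w pq E'_def by (simp add: algebra_simps)
    finally show ?thesis .
  qed
  ultimately show ?thesis using E w pq by (blast intro: closed unit_C)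
qed

lemma extra_gen_mod_y0:
  assumes "extra_gen j a E"
  shows "\<exists>u d. unit u \<and> d \<in> C \<and> E = u * (y 1 ^ j * y 2 ^ a) + y 0 * d"
proof -
  obtain u F where E: "unit u" "F \<in> I j" "E = u * y 2 ^ a * G j + y 0 * F"
    using assms by (auto simp: extra_gen_def)
  obtain w d where w: "unit w" "d \<in> C" "G j = w * y 1 ^ j + y 0 * d" using G_mod_y0 by blast
  have "E = (u * w) * (y 1 ^ j * y 2 ^ a) + y 0 * (u * y 2 ^ a * d + F)"
    unfolding E(3) w(3) by (simp add: algebra_simps)
  moreover have "u * y 2 ^ a * d + F \<in> C" using E w I_subset_C by (simp add: closed unit_C)
  ultimately show ?thesis using unit_mult E w by blast
qed

text \<open>
  This sum is, up to sign, the derivative of \<open>f\<close> by \<open>y\<^sub>0\<close> for \<open>n = m + 2\<close>, from which the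
  induction starts: the term for \<open>k = 2\<close> is
  \<open>y\<^sub>2 G\<^sub>m\<close>, and the others are \<open>y\<^sub>0\<close> times multiples of generators of \<open>I\<^sub>m\<close>.
\<close>

lemma extra_gen_y0_derivative:
  "extra_gen m 1 (\<Sum>k=2..m+2. of_nat (k - 1) * y k * y 0 ^ (k - 2) * G (m + 2 - k))"
proof -
  define g where "g k = of_nat (k - 1) * y k * y 0 ^ (k - 2) * G (m + 2 - k)" for k
  define F where "F = (\<Sum>k=3..m+2. of_nat (k - 1) * y k * y 0 ^ (k - 3) * G (m + 2 - k))"
  have F: "F \<in> I m"
    unfolding F_def
  proof (intro I_sum)
    fix k assume "k \<in> {3..m+2}"
    then obtain l where "k = l + 3" "l < m" by (auto simp: less_eq_Suc_le dest!: le_Suc_ex)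
    then have "y 0 ^ (k - 3) * G (m + 2 - k) \<in> I m"
      using y0_power_G_in_I[of l m] by (simp add: numeral_eq_Suc)
    then show "of_nat (k - 1) * y k * y 0 ^ (k - 3) * G (m + 2 - k) \<in> I m"
      using I_mult[of "of_nat (k - 1) * y k"] by (simp only: mult.assoc closed)
  qed
  have tail: "sum g {3..m+2} = y 0 * F"
    unfolding F_def sum_distrib_left
  proof (intro sum.cong refl)
    fix k assume "k \<in> {3..m+2}"
    then obtain l where "k = l + 3" by (metis add.commute atLeastAtMost_iff le_Suc_ex)
    then show "g k = y 0 * (of_nat (k - 1) * y k * y 0 ^ (k - 3) * G (m + 2 - k))"
      by (simp add: g_def ac_simps)
  qed
  have "{2..m+2} = insert 2 {3..m+2}" by auto
  then have "sum g {2..m+2} = 1 * y 2 ^ 1 * G m + y 0 * F"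
    unfolding tail[symmetric] by (simp add: g_def)
  moreover have "unit 1" by (auto simp: unit_def closed)
  ultimately show ?thesis unfolding extra_gen_def g_def using F by blast
qed

text \<open>
  The ideal \<open>I\<^sub>j\<^sub>+\<^sub>2 + (E)\<close>. With \<open>j = n - 2\<close> and \<open>E\<close> the derivative by \<open>y\<^sub>0\<close>, up to sign, it is the gradient ideal.
\<close>

definition K :: "nat \<Rightarrow> 'a \<Rightarrow> 'a set" where
  "K j E = {p + b * E | p b. p \<in> I (j + 2) \<and> b \<in> C}"

lemma KI: "p \<in> I (j + 2) \<Longrightarrow> b \<in> C \<Longrightarrow> p + b * E \<in> K j E" by (auto simp: K_def)

lemma E_in_K: "E \<in> K j E" using KI[OF I_zero one_C] by simp

lemma I_in_K: "p \<in> I (j + 2) \<Longrightarrow> p \<in> K j E" using KI[OF _ zero_C] by fastforce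

lemma ideal_K: assumes "E \<in> C" shows "ideal_in (K j E)"
proof (rule ideal_inI)
  show "0 \<in> K j E" using KI[OF I_zero zero_C] by simp
  fix q assume "q \<in> K j E"
  then obtain p b where q: "p \<in> I (j + 2)" "b \<in> C" "q = p + b * E" by (auto simp: K_def)
  then show "q \<in> C" using assms I_subset_C by (auto simp: closed)
  show "c * q \<in> K j E" if "c \<in> C" for c
    using KI[of "c * p" j "c * b" E] q that by (simp add: algebra_simps I_mult closed)
  fix q' assume "q' \<in> K j E"
  then obtain p' b' where "p' \<in> I (j + 2)" "b' \<in> C" "q' = p' + b' * E" by (auto simp: K_def)
  then show "q + q' \<in> K j E"
    using KI[of "p + p'" j "b + b'" E] q by (simp add: algebra_simps I_add closed)
qed

lemma K_subset_monomial_ideal: assumes "extra_gen j a E" shows "K j E \<subseteq> monomial_ideal j a"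
proof
  fix q assume "q \<in> K j E"
  then obtain p b where q: "p \<in> I (Suc (Suc j))" "b \<in> C" "q = p + b * E" by (auto simp: K_def)
  obtain p1 c where p: "p1 \<in> I (Suc j)" "c \<in> C" "p = y 0 * p1 + c * G (Suc j)"
    using q(1) by (rule I_SucE)
  obtain w d where w: "unit w" "d \<in> C" "G (Suc j) = w * y 1 ^ Suc j + y 0 * d" using G_mod_y0 by blast
  obtain u d' where u: "unit u" "d' \<in> C" "E = u * (y 1 ^ j * y 2 ^ a) + y 0 * d'"
    using extra_gen_mod_y0 assms by blast
  note [intro] = ideal_add[OF ideal_monomial_ideal] ideal_mult[OF ideal_monomial_ideal]
  have "G (Suc j) \<in> monomial_ideal j a"
    unfolding w(3) using w(1,2) y1_power_monomial_ideal y0_monomial_ideal unit_C by blast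
  moreover have "E \<in> monomial_ideal j a"
    unfolding u(3) using u(1,2) y1_y2_power_monomial_ideal y0_monomial_ideal unit_C by blast
  ultimately show "q \<in> monomial_ideal j a"
    unfolding q(3) p(3) using q(2) p(1,2) y0_monomial_ideal I_subset_C by blast
qed

text \<open>
  Together with \<open>K_subset_monomial_ideal\<close> this says that \<open>K + (y\<^sub>0)\<close> is the monomial ideal.
\<close>

lemma monomial_ideal_K:
  assumes E: "extra_gen j a E" and z: "z \<in> monomial_ideal j a"
  shows "\<exists>q\<in>K j E. \<exists>r\<in>C. z = q + y 0 * r"
proof -
  note K = ideal_K[OF extra_gen_C[OF E], of j]
  obtain w d where w: "unit w" "d \<in> C" "G (Suc j) = w * y 1 ^ Suc j + y 0 * d" using G_mod_y0 by blast
  obtain w' where w': "unit w'" "w * w' = 1" using unit_inverse w by blast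
  obtain u d' where u: "unit u" "d' \<in> C" "E = u * (y 1 ^ j * y 2 ^ a) + y 0 * d'"
    using extra_gen_mod_y0 E by blast
  obtain u' where u': "unit u'" "u * u' = 1" using unit_inverse u by blast
  obtain v s t where zz: "v \<in> V 1" "s \<in> C" "t \<in> C" "z = v + y 1 ^ Suc j * s + y 1 ^ j * y 2 ^ a * t"
    using z by (rule monomial_idealE)
  then obtain r where r: "r \<in> C" "v = y 0 * r" by (auto simp: V_1)
  have 1: "y 1 ^ Suc j = w' * (G (Suc j) - y 0 * d)"
    by (rule cancel_unit[OF w'(2)]) (simp add: w)
  have 2: "y 1 ^ j * y 2 ^ a = u' * (E - y 0 * d')"
    by (rule cancel_unit[OF u'(2)]) (simp add: u)
  have "z = (w' * s * G (Suc j) + u' * t * E) + y 0 * (r - w' * s * d - u' * t * d')"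
    unfolding zz(4) r(2) 1 2 by (simp add: algebra_simps)
  moreover have "G (Suc j) \<in> K j E" using G_I[of "Suc j"] by (intro I_in_K) simp
  then have "w' * s * G (Suc j) + u' * t * E \<in> K j E"
    using w' u' zz E_in_K by (simp add: ideal_add[OF K] ideal_mult[OF K] closed unit_C)
  moreover have "r - w' * s * d - u' * t * d' \<in> C"
    using w w' u u' zz r by (simp add: closed unit_C)
  ultimately show ?thesis by blast
qed

text \<open>
  For \<open>j = 0\<close> the element \<open>y\<^sub>0 = y\<^sub>0 G\<^sub>0\<close> already lies in \<open>I\<^sub>2\<close>.
\<close>

lemma K_0: assumes "extra_gen 0 a E" shows "K 0 E = monomial_ideal 0 a"
proof (intro equalityI subsetI)
  fix z assume "z \<in> monomial_ideal 0 a"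
  then obtain q r where q: "q \<in> K 0 E" "r \<in> C" "z = q + y 0 * r" using monomial_ideal_K assms by blast
  have "r \<in> I 1" using I_SucI[OF I_zero q(2), of 0] by (simp add: G_0)
  then have "y 0 * r \<in> K 0 E" using y0_I[of r 1] by (intro I_in_K) (simp add: numeral_2_eq_2)
  then show "z \<in> K 0 E" using q ideal_add[OF ideal_K[OF extra_gen_C[OF assms]]] by blast
qed (use K_subset_monomial_ideal[OF assms] in blast)

text \<open>
  If \<open>y\<^sub>0 h = p + b E\<close>, compare both sides modulo \<open>y\<^sub>0\<close>: there \<open>p\<close> is a multiple of \<open>y\<^sub>1\<^bsup>j+2\<^esup>\<close> and \<open>E\<close>
  a unit times \<open>y\<^sub>1\<^bsup>j+1\<^esup> y\<^sub>2\<^sup>a\<close>, so \<open>b \<in> P\<close>. Hence \<open>b E\<close> is a combination of \<open>y\<^sub>0 E\<close> and \<open>y\<^sub>1 E\<close>, and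
  \<open>extra_gen_step\<close> rewrites \<open>y\<^sub>1 E\<close>; then \<open>y\<^sub>0\<close> can be cancelled. Since both \<open>E\<close> and
  \<open>G\<^sub>j\<^sub>+\<^sub>2\<close> lie in \<open>I\<^sub>j\<^sub>+\<^sub>2\<close>, the only new generator of the quotient is \<open>E'\<close>.
\<close>

lemma K_colon_y0:
  assumes E: "extra_gen (Suc j) a E"
  shows "\<exists>E'. extra_gen j (Suc a) E' \<and> (\<forall>h\<in>C. y 0 * h \<in> K (Suc j) E \<longleftrightarrow> h \<in> K j E')"
proof -
  obtain E' c i where E': "extra_gen j (Suc a) E'" "c \<in> C" "i \<in> I (j + 2)"
    "y 1 * E = c * y 2 ^ a * G (j + 2) + y 0 * (E' + i)"
    using extra_gen_step[OF E] by blast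
  note K = ideal_K[OF extra_gen_C[OF E], of "Suc j"]
  have EI: "E \<in> I (j + 2)" using extra_gen_in_I[OF E] by simp
  have GI: "G (j + 2) \<in> I (j + 2)" by (rule G_in_I) simp
  have "h \<in> K j E'" if h: "h \<in> C" "y 0 * h \<in> K (Suc j) E" for h
  proof -
    obtain p b where p: "p \<in> I (Suc (j + 2))" "b \<in> C" "y 0 * h = p + b * E"
      using h(2) by (auto simp: K_def)
    obtain p1 g where p1: "p1 \<in> I (j + 2)" "g \<in> C" "p = y 0 * p1 + g * G (j + 2)"
      using p(1) by (rule I_SucE)
    obtain w d where w: "unit w" "d \<in> C" "G (j + 2) = w * y 1 ^ (j + 2) + y 0 * d"
      using G_mod_y0 by blast
    obtain u d' where u: "unit u" "d' \<in> C" "E = u * (y 1 ^ Suc j * y 2 ^ a) + y 0 * d'"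
      using extra_gen_mod_y0 E by blast
    have "y 1 ^ Suc j * (g * w * y 1 + b * u * y 2 ^ a) = y 0 * (h - p1 - g * d - b * d')"
      using p(3) unfolding p1(3) u(3) w(3) by (simp add: algebra_simps)
    also have "\<dots> \<in> V 1" using h p1 p w u I_subset_C by (simp add: y0_V_1 closed)
    finally have *: "g * w * y 1 + b * u * y 2 ^ a \<in> V 1"
      using V_cancel[of 1 _ "Suc j"] p1 w p u by (simp add: closed unit_C)
    \<comment> \<open>Hence \<open>b y\<^sub>2\<^sup>a \<in> P\<close>, and \<open>y\<^sub>2\<close> can be cancelled modulo the prime \<open>P\<close>.\<close>
    have "u * (y 2 ^ a * b) = (g * w * y 1 + b * u * y 2 ^ a) + y 1 * (- (g * w))"
      by (simp add: algebra_simps)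
    also have "\<dots> \<in> V 2" unfolding V_2 using * p1 w by (blast intro: closed unit_C)
    finally have "y 2 ^ a * b \<in> V 2" using ideal_unit[OF ideal_V u(1)] by blast
    then have "b \<in> V 2" using V_cancel[of 2 b a] p by simp
    then obtain b0 b1 where b: "b0 \<in> C" "b1 \<in> C" "b = y 0 * b0 + y 1 * b1" by (auto simp: V_2 V_1)
    have eq: "y 0 * h = y 0 * (p1 + b0 * E + b1 * (E' + i)) + (g + b1 * c * y 2 ^ a) * G (j + 2)"
    proof -
      have "y 0 * h = y 0 * p1 + g * G (j + 2) + y 0 * b0 * E + b1 * (y 1 * E)"
        using p(3) unfolding p1(3) b(3) by (simp add: algebra_simps)
      then show ?thesis unfolding E'(4) by (simp add: algebra_simps)
    qed
    \<comment> \<open>Modulo \<open>y\<^sub>0\<close>, \<open>G\<^sub>j\<^sub>+\<^sub>2\<close> is a unit times a power of \<open>y\<^sub>1\<close>, so its coefficient is divisible by \<open>y\<^sub>0\<close>.\<close>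
    define k where "k = g + b1 * c * y 2 ^ a"
    have kC: "k \<in> C" unfolding k_def using p1 b E' by (simp add: closed)
    have "w * (y 1 ^ (j + 2) * k) = y 0 * (h - (p1 + b0 * E + b1 * (E' + i)) - k * d)"
      using eq unfolding k_def[symmetric] w(3) by (simp add: algebra_simps)
    also have "\<dots> \<in> V 1"
      using h p1 b E' I_subset_C extra_gen_C[OF E] extra_gen_C[OF E'(1)] kC w by (simp add: y0_V_1 closed)
    finally have "y 1 ^ (j + 2) * k \<in> V 1" using ideal_unit[OF ideal_V w(1)] by blast
    then have "k \<in> V 1" using V_cancel[of 1 k "j + 2"] kC by simp
    then obtain l where l: "l \<in> C" "k = y 0 * l" by (auto simp: V_1)
    have "y 0 * h = y 0 * (p1 + b0 * E + b1 * (E' + i) + l * G (j + 2))"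
      using eq unfolding k_def[symmetric] l(2) by (simp add: algebra_simps)
    moreover have "y 0 \<noteq> 0" using y_notin_vars[of 0] by (auto simp: vars_ideal_0)
    ultimately have "h = p1 + b0 * E + b1 * (E' + i) + l * G (j + 2)" by simp
    also have "\<dots> = (p1 + b0 * E + b1 * i + l * G (j + 2)) + b1 * E'" by (simp add: algebra_simps)
    also have "\<dots> \<in> K j E'"
      using p1 b E' l EI GI by (intro KI) (simp_all add: I_add I_mult)
    finally show ?thesis .
  qed
  moreover have "y 0 * h \<in> K (Suc j) E" if h': "h \<in> K j E'" for h
  proof -
    obtain p b where h: "p \<in> I (j + 2)" "b \<in> C" "h = p + b * E'" using h' unfolding K_def by blast
    have "(b * y 1) * E = b * (c * y 2 ^ a * G (j + 2) + y 0 * (E' + i))"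
      using E'(4) by (simp add: mult.assoc)
    then have "y 0 * h = (y 0 * (p - b * i) + (- b * c * y 2 ^ a) * G (j + 2)) + (b * y 1) * E"
      unfolding h(3) by (simp add: algebra_simps)
    also have "\<dots> \<in> K (Suc j) E"
      using h E' I_SucI[of "p - b * i" "j + 2" "- b * c * y 2 ^ a"]
      by (intro KI) (simp_all add: closed I_diff I_mult)
    finally show ?thesis .
  qed
  ultimately show ?thesis using E'(1) by blast
qed

text \<open>
  The element form of the inclusion of \<open>Ass (R / K)\<close> in \<open>Ass (R / (K : y\<^sub>0)) \<union> Ass (R / (K + (y\<^sub>0)))\<close>:
  either some nonzero multiple of the class of \<open>x\<close> lies in \<open>y\<^sub>0 R / K\<close>, and this multiple has the same
  annihilator \<open>p\<close>, or the submodule generated by the class of \<open>x\<close> embeds in \<open>R / (K + (y\<^sub>0))\<close>.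
\<close>

lemma K_assoc:
  assumes "extra_gen j a E" "x \<in> C" "prime_in p" "p = colon (K j E) x"
  shows "p = V 2 \<or> p = V 3"
  using assms
proof (induction j arbitrary: a E x)
  case 0
  then show ?case using monomial_ideal_assoc[of p 0 a x] K_0[of a E] by simp
next
  case (Suc j)
  note p = Suc.prems(3,4) and x = Suc.prems(2)
  note K = ideal_K[OF extra_gen_C[OF Suc.prems(1)], of "Suc j"]
  show ?case
  proof (cases "\<exists>r\<in>C. r * x \<notin> K (Suc j) E \<and> r * x \<in> monomial_ideal (Suc j) a")
    case True
    then obtain r where r: "r \<in> C" "r * x \<notin> K (Suc j) E" "r * x \<in> monomial_ideal (Suc j) a" by blast
    then obtain q z where z: "q \<in> K (Suc j) E" "z \<in> C" "r * x = q + y 0 * z"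
      using monomial_ideal_K Suc.prems(1) by blast
    obtain E' where E': "extra_gen j (Suc a) E'" "\<forall>h\<in>C. y 0 * h \<in> K (Suc j) E \<longleftrightarrow> h \<in> K j E'"
      using K_colon_y0 Suc.prems(1) by blast
    have "h \<in> p \<longleftrightarrow> h * z \<in> K j E'" if h: "h \<in> C" for h
    proof -
      have eq: "y 0 * (h * z) = r * (h * x) - h * q"
        using arg_cong[OF z(3), of "\<lambda>t. h * t"] by (simp add: algebra_simps)
      have hq: "h * q \<in> K (Suc j) E" by (rule ideal_mult[OF K h z(1)])
      have "y 0 * (h * z) \<in> K (Suc j) E \<longleftrightarrow> r * (h * x) \<in> K (Suc j) E"
        using ideal_diff[OF K _ hq, of "r * (h * x)"] ideal_add[OF K _ hq, of "y 0 * (h * z)"] eq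
        by auto
      also have "r * (h * x) \<in> K (Suc j) E \<longleftrightarrow> h * r \<in> p"
        using h r by (simp add: p(2) colon_def mult_C ac_simps)
      also have "\<dots> \<longleftrightarrow> h \<in> p"
      proof
        have "r \<notin> p" using r(2) by (simp add: p(2) colon_def)
        then show "h \<in> p" if "h * r \<in> p" using prime_inD[OF p(1) h r(1)] that by blast
        show "h * r \<in> p" if "h \<in> p"
          using ideal_mult'[OF ideal_colon[OF K x] r(1)] that unfolding p(2) .
      qed
      finally show ?thesis using E'(2) mult_C[OF h z(2)] by blast
    qed
    moreover have "p \<subseteq> C" unfolding p(2) colon_def by blast
    ultimately have "p = colon (K j E') z" unfolding colon_def by blast
    from Suc.IH[OF E'(1) z(2) p(1) this] show ?thesis .
  next
    case False
    then have "colon (K (Suc j) E) x = colon (monomial_ideal (Suc j) a) x"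
      using K_subset_monomial_ideal[OF Suc.prems(1)] unfolding colon_def by blast
    then show ?thesis using monomial_ideal_assoc[OF p(1) _ x] p(2) by simp
  qed
qed

text \<open>
  The witness is \<open>y\<^sub>0\<^sup>j y\<^sub>2\<^bsup>a+j\<^esup>\<close>.
\<close>

lemma witness_Q:
  assumes "extra_gen j (Suc a) E"
  shows "\<exists>x\<in>C. V 3 = colon (K j E) x"
  using assms
proof (induction j arbitrary: a E)
  case 0
  have "h * y 2 ^ a \<in> monomial_ideal 0 (Suc a) \<longleftrightarrow> h \<in> V 3" if h: "h \<in> C" for h
  proof
    assume "h * y 2 ^ a \<in> monomial_ideal 0 (Suc a)"
    then obtain v s t where hx: "v \<in> V 1" "s \<in> C" "t \<in> C"
      "h * y 2 ^ a = v + y 1 ^ Suc 0 * s + y 1 ^ 0 * y 2 ^ Suc a * t"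
      by (rule monomial_idealE)
    then have "y 2 ^ a * (h - y 2 * t) = v + y 1 * s" by (simp add: algebra_simps)
    also have "\<dots> \<in> V 2" using hx by (auto simp: V_2)
    finally have "h - y 2 * t \<in> V 2" using V_cancel[of 2 _ a] h hx by (simp add: closed)
    then show "h \<in> V 3" unfolding V_3 using hx by (intro bexI[of _ "h - y 2 * t"] bexI[of _ t]) auto
  next
    assume "h \<in> V 3"
    then obtain v s t where "v \<in> V 1" "s \<in> C" "t \<in> C" "h = v + y 1 * s + y 2 * t"
      by (auto simp: V_3 V_2)
    then show "h * y 2 ^ a \<in> monomial_ideal 0 (Suc a)"
      by (intro monomial_idealI[of "v * y 2 ^ a" "s * y 2 ^ a" t])
        (auto simp: algebra_simps closed intro!: ideal_mult'[OF ideal_V] closed)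
  qed
  then have "V 3 = colon (K 0 E) (y 2 ^ a)"
    unfolding K_0[OF 0] colon_def using ideal_C[OF ideal_V] by auto
  then show ?case using power_C[OF y_C] by blast
next
  case (Suc j)
  obtain E' where E': "extra_gen j (Suc (Suc a)) E'" "\<forall>h\<in>C. y 0 * h \<in> K (Suc j) E \<longleftrightarrow> h \<in> K j E'"
    using K_colon_y0 Suc.prems(1) by blast
  obtain x where x: "x \<in> C" "V 3 = colon (K j E') x" using Suc.IH[OF E'(1)] by blast
  have "y 0 * (h * x) \<in> K (Suc j) E \<longleftrightarrow> h * x \<in> K j E'" if "h \<in> C" for h
    using E'(2) mult_C[OF that x(1)] by blast
  then have "V 3 = colon (K (Suc j) E) (y 0 * x)"
    unfolding x(2) colon_def mult.left_commute[of _ "y 0"] by blast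
  then show ?case using mult_C[OF y_C x(1)] by blast
qed

text \<open>
  The witness is a power of \<open>y\<^sub>0\<close> times a power of \<open>y\<^sub>2\<close>. After all but one of the divisions by
  \<open>y\<^sub>0\<close>, \<open>y\<^sub>0 y\<^sub>2\<^bsup>a+1\<^esup>\<close> lies in the ideal, and because \<open>E\<close> is \<open>y\<^sub>1 y\<^sub>2\<^sup>a\<close> up to a unit and multiples of \<open>y\<^sub>0\<close>, so
  does \<open>y\<^sub>1 y\<^sub>2\<^bsup>2a+1\<^esup>\<close>.
\<close>

lemma witness_P:
  assumes "extra_gen (Suc j) a E"
  shows "\<exists>x\<in>C. V 2 = colon (K (Suc j) E) x"
  using assms
proof (induction j arbitrary: a E)
  case 0
  note K = ideal_K[OF extra_gen_C[OF 0], of "Suc 0"]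
  obtain E' where E': "extra_gen 0 (Suc a) E'" "\<forall>h\<in>C. y 0 * h \<in> K (Suc 0) E \<longleftrightarrow> h \<in> K 0 E'"
    using K_colon_y0 0 by blast
  have y0: "y 0 * y 2 ^ Suc a \<in> K (Suc 0) E"
    using E' y1_y2_power_monomial_ideal[of 0 "Suc a"] K_0 by (simp add: closed)
  obtain u d where u: "unit u" "d \<in> C" "E = u * (y 1 ^ Suc 0 * y 2 ^ a) + y 0 * d"
    using extra_gen_mod_y0 0 by blast
  define x where "x = y 2 ^ a * y 2 ^ Suc a"
  have x: "x \<in> C" unfolding x_def by (intro closed)
  have "u * (y 1 * x) = y 2 ^ Suc a * E - d * (y 0 * y 2 ^ Suc a)"
    unfolding u(3) x_def by (simp add: algebra_simps)
  also have "\<dots> \<in> K (Suc 0) E"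
    by (intro ideal_diff[OF K] ideal_mult[OF K] y0 u E_in_K closed)
  finally have "y 1 * x \<in> K (Suc 0) E" using ideal_unit[OF K u(1)] by blast
  moreover have "y 0 * x \<in> K (Suc 0) E"
    using ideal_mult[OF K _ y0, of "y 2 ^ a"] by (simp add: x_def closed ac_simps)
  ultimately have "V 2 \<subseteq> colon (K (Suc 0) E) x"
    by (intro V_2_subset ideal_colon K x) (simp_all add: colon_def closed)
  moreover have "h \<in> V 2" if h: "h \<in> C" "h * x \<in> K (Suc 0) E" for h
  proof -
    have "h * x \<in> monomial_ideal (Suc 0) a" using h K_subset_monomial_ideal 0 by blast
    then have "h * x \<in> V 2" using monomial_ideal_P[of "h * x" "Suc 0" a] by (auto simp: V_2)
    moreover have "h * x = y 2 ^ (a + Suc a) * h" by (simp add: x_def power_add)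
    ultimately show ?thesis using V_cancel[of 2 h "a + Suc a"] h by simp
  qed
  ultimately have "V 2 = colon (K (Suc 0) E) x" by (auto simp: colon_def)
  then show ?case using x by blast
next
  case (Suc j)
  obtain E' where E': "extra_gen (Suc j) (Suc a) E'"
    "\<forall>h\<in>C. y 0 * h \<in> K (Suc (Suc j)) E \<longleftrightarrow> h \<in> K (Suc j) E'"
    using K_colon_y0 Suc.prems(1) by blast
  obtain x where x: "x \<in> C" "V 2 = colon (K (Suc j) E') x" using Suc.IH[OF E'(1)] by blast
  have "y 0 * (h * x) \<in> K (Suc (Suc j)) E \<longleftrightarrow> h * x \<in> K (Suc j) E'" if "h \<in> C" for h
    using E'(2) mult_C[OF that x(1)] by blast
  then have "V 2 = colon (K (Suc (Suc j)) E) (y 0 * x)"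
    unfolding x(2) colon_def mult.left_commute[of _ "y 0"] by blast
  then show ?case using mult_C[OF y_C x(1)] by blast
qed

theorem associated_primes_K:
  assumes "extra_gen (Suc j) (Suc a) E"
  shows "{p. prime_in p \<and> (\<exists>x\<in>C. p = colon (K (Suc j) E) x)} = {V 2, V 3}"
  using K_assoc[OF assms] witness_P[OF assms] witness_Q[OF assms] prime_vars[of 2] prime_vars[of 3]
  by auto

end

section \<open>Derivations and zero substitutions of polynomials\<close>

lemma mpoly_eq_sum_single:
  "(\<Sum>m\<in>Poly_Mapping.keys p. Poly_Mapping.single m (Poly_Mapping.lookup p m)) = p"
  by (rule poly_mapping_eqI) (auto simp: lookup_sum lookup_single when_def in_keys_iff)

lemma mpoly_induct [case_names zero plus]:
  assumes "Q 0" and "\<And>p m c. Q p \<Longrightarrow> Q (p + Poly_Mapping.single m c)"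
  shows "Q (p :: 'k::comm_ring_1 mpoly)"
proof -
  have "Q (\<Sum>m\<in>A. Poly_Mapping.single m (Poly_Mapping.lookup p m))" if "finite A" for A
    using that
  proof induction
    case (insert m A)
    then show ?case using assms(2)[OF insert.IH] by (simp add: add.commute)
  qed (simp add: assms)
  from this[of "Poly_Mapping.keys p"] show ?thesis by (simp add: mpoly_eq_sum_single)
qed

lemma partial_deriv_add: "partial_deriv i (p + q) = partial_deriv i p + partial_deriv i q"
  by (rule poly_mapping_eqI) (simp add: lookup_partial_deriv lookup_add distrib_left)

lemma partial_deriv_0 [simp]: "partial_deriv i 0 = 0"
  by (simp add: partial_deriv_def)

lemma partial_deriv_uminus: "partial_deriv i (- p) = - partial_deriv i p"
  using partial_deriv_add[of i p "- p"] by (simp add: eq_neg_iff_add_eq_0 add.commute)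

lemma partial_deriv_sum: "partial_deriv i (sum g A) = (\<Sum>a\<in>A. partial_deriv i (g a))"
  by (induction A rule: infinite_finite_induct) (auto simp: partial_deriv_add)

lemma partial_deriv_single:
  "partial_deriv i (Poly_Mapping.single m c) =
    Poly_Mapping.single (m - Poly_Mapping.single i 1) (of_nat (Poly_Mapping.lookup m i) * c)"
  by (cases "c = 0") (auto simp: partial_deriv_def)

text \<open>
  By additivity it suffices to treat two monomials. The only subtlety is the truncated subtraction of
  exponents: a monomial without \<open>x\<^sub>i\<close> gets coefficient zero, so it may be moved inside the subtraction.
\<close>

lemma partial_deriv_mult:
  "partial_deriv i (p * q) = partial_deriv i p * q + p * partial_deriv i q"
proof (induction p rule: mpoly_induct)
  case (plus p m c)
  have "partial_deriv i (Poly_Mapping.single m c * q) =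
      partial_deriv i (Poly_Mapping.single m c) * q + Poly_Mapping.single m c * partial_deriv i q"
  proof (induction q rule: mpoly_induct)
    case (plus q m' c')
    let ?e = "Poly_Mapping.single i (1::nat)"
    have shift: "Poly_Mapping.single (a + b - ?e) (of_nat (Poly_Mapping.lookup a i) * z) =
        Poly_Mapping.single (a - ?e + b) (of_nat (Poly_Mapping.lookup a i) * z)" for a b z
    proof (cases "Poly_Mapping.lookup a i = 0")
      case False
      then have "a + b - ?e = a - ?e + b"
        by (intro poly_mapping_eqI) (auto simp: lookup_add lookup_minus lookup_single when_def)
      then show ?thesis by simp
    qed simp
    have "partial_deriv i (Poly_Mapping.single m c * Poly_Mapping.single m' c') =
        Poly_Mapping.single (m + m' - ?e) (of_nat (Poly_Mapping.lookup m i) * (c * c')) +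
        Poly_Mapping.single (m' + m - ?e) (of_nat (Poly_Mapping.lookup m' i) * (c * c'))"
      by (simp add: mult_single partial_deriv_single lookup_add single_add[symmetric]
          distrib_right add.commute[of m'])
    also have "\<dots> = partial_deriv i (Poly_Mapping.single m c) * Poly_Mapping.single m' c' +
        Poly_Mapping.single m c * partial_deriv i (Poly_Mapping.single m' c')"
      unfolding shift by (simp add: mult_single partial_deriv_single ac_simps)
    finally show ?case
      using plus by (simp add: distrib_left partial_deriv_add algebra_simps)
  qed simp
  then show ?case using plus by (simp add: distrib_right partial_deriv_add algebra_simps)
qed simp

lemma partial_deriv_1 [simp]: "partial_deriv i 1 = 0"
  using partial_deriv_mult[of i 1 1] by simp

lemma partial_deriv_Var: "partial_deriv i (Var j) = (if i = j then 1 else 0)"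
  by (auto simp: Var_def partial_deriv_single lookup_single when_def)

lemma partial_deriv_power: "partial_deriv i (p ^ k) = of_nat k * p ^ (k - 1) * partial_deriv i p"
proof (induction k)
  case (Suc k)
  then show ?case by (cases k) (simp_all add: partial_deriv_mult algebra_simps)
qed simp

text \<open>
  Substitution of zero for the variables with index in \<open>X\<close>. It is a ring homomorphism; if the
  coefficients form an integral domain, then so do the polynomials, and the kernel is prime.
\<close>

definition kill_vars :: "nat set \<Rightarrow> 'k::comm_ring_1 mpoly \<Rightarrow> 'k mpoly" where
  "kill_vars X p = (\<Sum>m \<in> Poly_Mapping.keys p.
     if Poly_Mapping.keys m \<inter> X = {} then Poly_Mapping.single m (Poly_Mapping.lookup p m) else 0)"

lemma lookup_kill_vars:
  "Poly_Mapping.lookup (kill_vars X p) m =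
    (if Poly_Mapping.keys m \<inter> X = {} then Poly_Mapping.lookup p m else 0)"
proof -
  have "Poly_Mapping.lookup (kill_vars X p) m = (\<Sum>m' \<in> Poly_Mapping.keys p.
      if m' = m then (if Poly_Mapping.keys m \<inter> X = {} then Poly_Mapping.lookup p m else 0) else 0)"
    unfolding kill_vars_def lookup_sum by (intro sum.cong) (auto simp: lookup_single when_def)
  then show ?thesis by (auto simp: in_keys_iff)
qed

lemma kill_vars_0 [simp]: "kill_vars X 0 = 0" by (simp add: kill_vars_def)

lemma kill_vars_add: "kill_vars X (p + q) = kill_vars X p + kill_vars X q"
  by (rule poly_mapping_eqI) (simp add: lookup_kill_vars lookup_add)

lemma kill_vars_sum: "kill_vars X (sum g A) = (\<Sum>a\<in>A. kill_vars X (g a))"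
  by (induction A rule: infinite_finite_induct) (auto simp: kill_vars_add)

lemma kill_vars_single: "kill_vars X (Poly_Mapping.single m c) =
    (if Poly_Mapping.keys m \<inter> X = {} then Poly_Mapping.single m c else 0)"
  by (auto simp: kill_vars_def)

lemma keys_add_exponents:
  "Poly_Mapping.keys (m + m' :: nat \<Rightarrow>\<^sub>0 nat) = Poly_Mapping.keys m \<union> Poly_Mapping.keys m'"
  by (auto simp: in_keys_iff lookup_add)

lemma kill_vars_mult: "kill_vars X (p * q) = kill_vars X p * kill_vars X q"
proof (induction p rule: mpoly_induct)
  case (plus p m c)
  have "kill_vars X (Poly_Mapping.single m c * q) = kill_vars X (Poly_Mapping.single m c) * kill_vars X q"
  proof (induction q rule: mpoly_induct)
    case (plus q m' c')
    have "kill_vars X (Poly_Mapping.single m c * Poly_Mapping.single m' c') =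
      kill_vars X (Poly_Mapping.single m c) * kill_vars X (Poly_Mapping.single m' c')"
      by (auto simp: mult_single kill_vars_single keys_add_exponents Int_Un_distrib2)
    then show ?case using plus by (simp add: kill_vars_add distrib_left)
  qed simp
  then show ?case using plus by (simp add: kill_vars_add distrib_right)
qed simp

lemma kill_vars_1: "kill_vars X 1 = 1"
  using kill_vars_single[of X 0 1] by simp

lemma kill_vars_Var: "kill_vars X (Var i) = (if i \<in> X then 0 else Var i)"
  by (simp add: Var_def kill_vars_single)

lemma Var_nonzero: "Var i \<noteq> (0 :: 'k::comm_ring_1 mpoly)"
  by (metis Var_def keys_single keys_zero insert_not_empty zero_neq_one)

text \<open>
  Zero beyond \<open>n\<close>, so that a variable of the ring never occurs under two indices and the partial
  derivative of \<open>y\<^sub>j\<close> by \<open>y\<^sub>k\<close> is the Kronecker delta for every \<open>j\<close>, if \<open>k \<le> n\<close>.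
\<close>

definition rev_var :: "nat \<Rightarrow> nat \<Rightarrow> 'k::comm_ring_1 mpoly" where
  "rev_var n k = (if k \<le> n then Var (n - k) else 0)"

lemma carrier_iff: "p \<in> carrier (poly_ring n) \<longleftrightarrow> (\<forall>m \<in> Poly_Mapping.keys p. Poly_Mapping.keys m \<subseteq> {0..n})"
  by (simp add: poly_ring_def)

lemma carrier_one: "1 \<in> carrier (poly_ring n)" and carrier_zero: "0 \<in> carrier (poly_ring n)"
  by (simp_all add: carrier_iff)

lemma carrier_add: "p \<in> carrier (poly_ring n) \<Longrightarrow> q \<in> carrier (poly_ring n) \<Longrightarrow> p + q \<in> carrier (poly_ring n)"
  and carrier_mult: "p \<in> carrier (poly_ring n) \<Longrightarrow> q \<in> carrier (poly_ring n) \<Longrightarrow> p * q \<in> carrier (poly_ring n)"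
proof -
  interpret cring "poly_ring n :: 'a mpoly ring" by (rule cring_poly_ring)
  show "p \<in> carrier (poly_ring n) \<Longrightarrow> q \<in> carrier (poly_ring n) \<Longrightarrow> p + q \<in> carrier (poly_ring n)"
    and "p \<in> carrier (poly_ring n) \<Longrightarrow> q \<in> carrier (poly_ring n) \<Longrightarrow> p * q \<in> carrier (poly_ring n)"
    using a_closed[of p q] m_closed[of p q] by (simp_all add: poly_ring_simps)
qed

lemma carrier_uminus: "p \<in> carrier (poly_ring n) \<Longrightarrow> - p \<in> carrier (poly_ring n)"
  by (simp add: carrier_iff in_keys_iff)

lemma carrier_const: "Poly_Mapping.single 0 c \<in> carrier (poly_ring n)"
  by (simp add: carrier_iff)

lemma carrier_rev_var: "rev_var n k \<in> carrier (poly_ring n)"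
  by (simp add: carrier_iff rev_var_def Var_def)

interpretation poly_ring: unital_subring "carrier (poly_ring n) :: 'k::comm_ring_1 mpoly set" for n
  by unfold_locales (fact carrier_one carrier_add carrier_mult carrier_uminus)+

text \<open>
  A polynomial vanishes under the substitution iff each of its monomials contains one of the variables;
  dividing each monomial by such a variable writes the polynomial in terms of the generators.
\<close>

lemma vars_ideal_iff_kill_vars:
  assumes "k \<le> Suc n"
  shows "a \<in> poly_ring.vars_ideal n (rev_var n) k \<longleftrightarrow>
    a \<in> carrier (poly_ring n) \<and> kill_vars {n - i | i. i < k} a = 0"
proof (intro iffI conjI)
  assume "a \<in> poly_ring.vars_ideal n (rev_var n) k"
  then obtain r where r: "\<forall>i<k. r i \<in> carrier (poly_ring n)" "a = (\<Sum>i<k. rev_var n i * r i)"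
    by (auto simp: poly_ring.vars_ideal_def)
  then show "a \<in> carrier (poly_ring n)"
    by (auto intro!: poly_ring.sum_C carrier_mult carrier_rev_var)
  have "kill_vars {n - i | i. i < k} (rev_var n i :: 'a mpoly) = 0" if "i < k" for i
    using that assms by (auto simp: rev_var_def kill_vars_Var)
  then show "kill_vars {n - i | i. i < k} a = 0"
    unfolding r(2) kill_vars_sum by (auto simp: kill_vars_mult)
next
  let ?X = "{n - i | i. i < k}"
  assume a: "a \<in> carrier (poly_ring n) \<and> kill_vars ?X a = 0"
  have "Poly_Mapping.single m (Poly_Mapping.lookup a m) \<in> poly_ring.vars_ideal n (rev_var n) k"
    if m: "m \<in> Poly_Mapping.keys a" for m
  proof -
    have "Poly_Mapping.keys m \<inter> ?X \<noteq> {}"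
      using a m lookup_kill_vars[of ?X a m] by (auto simp: in_keys_iff)
    then obtain i where i: "i < k" "Poly_Mapping.lookup m (n - i) \<noteq> 0"
      by (auto simp: in_keys_iff)
    let ?e = "Poly_Mapping.single (n - i) (1::nat)"
    let ?q = "Poly_Mapping.single (m - ?e) (Poly_Mapping.lookup a m)"
    have m_eq: "?e + (m - ?e) = m"
      using i by (intro poly_mapping_eqI) (auto simp: lookup_add lookup_minus lookup_single when_def)
    have "Poly_Mapping.keys (m - ?e) \<subseteq> {0..n}"
      using a m keys_add_exponents[of ?e "m - ?e"] unfolding m_eq by (auto simp: carrier_iff)
    then have q: "?q \<in> carrier (poly_ring n)" by (auto simp: carrier_iff)
    have "Poly_Mapping.single m (Poly_Mapping.lookup a m) = rev_var n i * ?q"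
      using i assms by (simp add: rev_var_def Var_def mult_single m_eq[unfolded One_nat_def])
    also have "\<dots> = (\<Sum>j<k. rev_var n j * (if j = i then ?q else 0))"
      using i by (simp add: if_distrib[of "\<lambda>x. _ * x"] sum.delta cong: if_cong)
    finally show ?thesis
      unfolding poly_ring.vars_ideal_def using q
      by (auto intro!: exI[of _ "\<lambda>j. if j = i then ?q else 0"] simp: carrier_zero)
  qed
  then have "(\<Sum>m\<in>Poly_Mapping.keys a. Poly_Mapping.single m (Poly_Mapping.lookup a m))
      \<in> poly_ring.vars_ideal n (rev_var n) k"
    by (rule poly_ring.ideal_sum[OF poly_ring.ideal_vars_ideal[OF carrier_rev_var]])
  then show "a \<in> poly_ring.vars_ideal n (rev_var n) k"
    by (simp add: mpoly_eq_sum_single)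
qed

lemma prime_vars_ideal:
  assumes "k \<le> Suc n"
  shows "poly_ring.prime_in n (poly_ring.vars_ideal n (rev_var n) k :: 'k::idom mpoly set)"
  unfolding poly_ring.prime_in_def using assms
  by (auto simp: vars_ideal_iff_kill_vars kill_vars_mult kill_vars_1)

lemma rev_var_notin_vars_ideal:
  assumes "k \<le> n"
  shows "rev_var n k \<notin> poly_ring.vars_ideal n (rev_var n) k"
  using assms by (auto simp: vars_ideal_iff_kill_vars rev_var_def kill_vars_Var Var_nonzero)

section \<open>The determinant as a coefficient of an inverse power series\<close>

no_notation vec_index (infixl "$" 100)
unbundle fps_syntax

text \<open>
  The series \<open>(y\<^sub>0 + y\<^sub>1 s + y\<^sub>2 s\<^sup>2 + \<dots>) / y\<^sub>0\<close> with \<open>s = y\<^sub>0 t\<close>; the substitution clears all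
  denominators.
\<close>

definition gen_series :: "(nat \<Rightarrow> 'a::comm_ring_1) \<Rightarrow> 'a fps" where
  "gen_series y = Abs_fps (\<lambda>k. if k = 0 then 1 else y k * y 0 ^ (k - 1))"

definition inv_series :: "(nat \<Rightarrow> 'a::comm_ring_1) \<Rightarrow> 'a fps" where
  "inv_series y = fps_right_inverse (gen_series y) 1"

lemma gen_mult_inv_series: "gen_series y * inv_series y = 1"
  unfolding inv_series_def by (rule fps_right_inverse) (simp add: gen_series_def)

definition grad_coeff :: "(nat \<Rightarrow> 'a::comm_ring_1) \<Rightarrow> nat \<Rightarrow> 'a" where
  "grad_coeff y m = (inv_series y ^ 2) $ m"

lemma inv_series_0: "inv_series y $ 0 = 1" by (simp add: inv_series_def)

lemma grad_coeff_0: "grad_coeff y 0 = 1" by (simp add: grad_coeff_def inv_series_0 power2_eq_square)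

text \<open>
  The identity \<open>Y (1 / Y\<^sup>2)' = - 2 Y' / Y\<^sup>2\<close>.
\<close>

lemma deriv_inverse_square:
  "gen_series y * fps_deriv (inv_series y ^ 2) =
    - (2 * fps_deriv (gen_series y) * inv_series y ^ 2)"
proof -
  have "fps_deriv (gen_series y * inv_series y) = 0" by (simp add: gen_mult_inv_series)
  then have *: "gen_series y * fps_deriv (inv_series y) =
      - (fps_deriv (gen_series y) * inv_series y)"
    by (simp add: eq_neg_iff_add_eq_0 add.commute)
  have "fps_deriv (inv_series y ^ 2) = 2 * inv_series y * fps_deriv (inv_series y)"
    by (simp add: power2_eq_square algebra_simps)
  then have "gen_series y * fps_deriv (inv_series y ^ 2) =
      2 * inv_series y * (gen_series y * fps_deriv (inv_series y))"
    by (simp add: ac_simps)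
  then show ?thesis unfolding * by (simp add: power2_eq_square ac_simps)
qed

text \<open>
  This compares coefficients in \<open>deriv_inverse_square\<close>, where \<open>m - k\<close> comes from the left-hand side and
  \<open>2 k\<close> from the right-hand side, with sum \<open>m + k\<close>.
\<close>

lemma grad_coeff_recurrence:
  "of_nat m * grad_coeff y m = - (\<Sum>k=1..m. of_nat (m + k) * y k * y 0 ^ (k - 1) * grad_coeff y (m - k))"
proof (cases m)
  case (Suc l)
  define z where "z k = gen_series y $ k" for k
  have z: "z 0 = 1" "k \<noteq> 0 \<Longrightarrow> z k = y k * y 0 ^ (k - 1)" for k by (simp_all add: z_def gen_series_def)
  have "(\<Sum>i=0..l. z i * (of_nat (m - i) * grad_coeff y (m - i))) =
      (gen_series y * fps_deriv (inv_series y ^ 2)) $ l"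
    unfolding fps_mult_nth by (intro sum.cong) (auto simp: z_def grad_coeff_def Suc Suc_diff_le)
  also have "\<dots> = - (2 * (\<Sum>i=0..l. (of_nat (Suc i) * z (Suc i)) * grad_coeff y (l - i)))"
  proof -
    have "(2 * fps_deriv (gen_series y) * inv_series y ^ 2) $ l =
        2 * ((fps_deriv (gen_series y) * inv_series y ^ 2) $ l)"
      by (simp add: mult.assoc numeral_fps_const)
    then show ?thesis
      unfolding deriv_inverse_square fps_mult_nth[of "fps_deriv (gen_series y)"]
      by (simp add: z_def grad_coeff_def)
  qed
  also have "(\<Sum>i=0..l. (of_nat (Suc i) * z (Suc i)) * grad_coeff y (l - i)) =
      (\<Sum>k=1..m. of_nat k * z k * grad_coeff y (m - k))"
    unfolding Suc One_nat_def by (subst sum.atLeast_Suc_atMost_Suc_shift) simp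
  also have "(\<Sum>i=0..l. z i * (of_nat (m - i) * grad_coeff y (m - i))) =
      of_nat m * grad_coeff y m + (\<Sum>k=1..m. of_nat (m - k) * z k * grad_coeff y (m - k))"
  proof -
    have "(\<Sum>i=0..l. z i * (of_nat (m - i) * grad_coeff y (m - i))) =
        (\<Sum>i=0..m. z i * (of_nat (m - i) * grad_coeff y (m - i)))"
      unfolding Suc by simp
    also have "\<dots> = of_nat m * grad_coeff y m + (\<Sum>k=1..m. z k * (of_nat (m - k) * grad_coeff y (m - k)))"
      by (subst sum.atLeast_Suc_atMost) (auto simp: z)
    finally show ?thesis by (simp add: ac_simps)
  qed
  finally have "of_nat m * grad_coeff y m =
      - (2 * (\<Sum>k=1..m. of_nat k * z k * grad_coeff y (m - k)))
      - (\<Sum>k=1..m. of_nat (m - k) * z k * grad_coeff y (m - k))"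
    by (rule eq_diff_eq[THEN iffD2])
  also have "\<dots> = - (\<Sum>k=1..m. (of_nat (m - k) + 2 * of_nat k) * z k * grad_coeff y (m - k))"
    by (simp only: distrib_right sum.distrib sum_distrib_left mult.assoc minus_add_distrib
        diff_conv_add_uminus add.commute)
  also have "(\<Sum>k=1..m. (of_nat (m - k) + 2 * of_nat k) * z k * grad_coeff y (m - k)) =
      (\<Sum>k=1..m. of_nat (m + k) * y k * y 0 ^ (k - 1) * grad_coeff y (m - k))"
  proof (intro sum.cong refl)
    fix k assume k: "k \<in> {1..m}"
    then have "of_nat (m - k) + 2 * of_nat k = (of_nat (m + k) :: 'a)"
      by (simp add: of_nat_diff)
    with k show "(of_nat (m - k) + 2 * of_nat k) * z k * grad_coeff y (m - k) =
        of_nat (m + k) * y k * y 0 ^ (k - 1) * grad_coeff y (m - k)"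
      by (simp add: z(2) algebra_simps)
  qed
  finally show ?thesis .
qed simp

lemma inv_series_recurrence:
  "inv_series y $ Suc m = - (\<Sum>k=1..Suc m. y 0 ^ (k - 1) * y k * inv_series y $ (Suc m - k))"
proof -
  have "0 = (gen_series y * inv_series y) $ Suc m" by (simp add: gen_mult_inv_series)
  also have "\<dots> = inv_series y $ Suc m + (\<Sum>k=1..Suc m. y 0 ^ (k - 1) * y k * inv_series y $ (Suc m - k))"
    unfolding fps_mult_nth
    by (subst sum.atLeast_Suc_atMost) (auto simp: gen_series_def ac_simps intro!: sum.cong)
  finally show ?thesis by (rule eq_neg_iff_add_eq_0[THEN iffD2, OF sym])
qed

text \<open>
  For \<open>r = 0\<close> this is the sub-Hankel matrix. The first column with its index shifted by \<open>r\<close> is needed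
  because deleting the last row and the second column shifts the first column against the others.
\<close>

definition hessenberg :: "(nat \<Rightarrow> 'a::comm_ring_1) \<Rightarrow> nat \<Rightarrow> nat \<Rightarrow> 'a mat" where
  "hessenberg y m r = mat m m (\<lambda>(i, j).
    if j = 0 then y (r + m - i) else if i + j \<le> m then y (m - i - j) else 0)"

lemma hessenberg_carrier: "hessenberg y m r \<in> carrier_mat m m" by (simp add: hessenberg_def)

text \<open>
  The last row has only the entries \<open>y\<^sub>r\<^sub>+\<^sub>1\<close> and \<open>y\<^sub>0\<close>, in the first two columns.
\<close>

lemma det_hessenberg_Suc:
  assumes "m \<noteq> 0"
  shows "det (hessenberg y (Suc m) r) =
    (-1) ^ m * (y (Suc r) * det (hessenberg y m 0) - y 0 * det (hessenberg y m (Suc r)))"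
proof -
  let ?A = "hessenberg y (Suc m) r"
  have "det ?A = (\<Sum>j<Suc m. ?A $$ (m, j) * cofactor ?A m j)"
    by (rule laplace_expansion_row[OF hessenberg_carrier]) simp
  also have "\<dots> = (\<Sum>j\<in>{0, 1}. ?A $$ (m, j) * cofactor ?A m j)"
    by (rule sum.mono_neutral_right) (use assms in \<open>auto simp: hessenberg_def\<close>)
  also have "\<dots> = y (Suc r) * cofactor ?A m 0 + y 0 * cofactor ?A m 1"
    using assms by (simp add: hessenberg_def)
  also have "mat_delete ?A m 0 = hessenberg y m 0"
    by (rule eq_matI) (auto simp: mat_delete_def hessenberg_def)
  then have "cofactor ?A m 0 = (-1) ^ m * det (hessenberg y m 0)" by (simp add: cofactor_def)
  also have "mat_delete ?A m 1 = hessenberg y m (Suc r)"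
    by (rule eq_matI) (auto simp: mat_delete_def hessenberg_def)
  then have "cofactor ?A m 1 = - ((-1) ^ m * det (hessenberg y m (Suc r)))" by (simp add: cofactor_def)
  finally show ?thesis by (simp add: algebra_simps)
qed

text \<open>
  Up to a factor \<open>(-1)\<^sup>m\<close>, the sign of the permutation that reverses the order of the rows.
\<close>

primrec reversal_sign :: "nat \<Rightarrow> 'a::comm_ring_1" where
  "reversal_sign 0 = 1"
| "reversal_sign (Suc m) = (-1) ^ Suc m * reversal_sign m"

lemma reversal_sign_cases: "(reversal_sign m :: 'a::comm_ring_1) = 1 \<or> (reversal_sign m :: 'a) = -1"
  by (induction m) (auto simp: minus_one_power_iff)

text \<open>
  This unrolls \<open>det_hessenberg_Suc\<close>. For \<open>r = 0\<close> the sum is the one in the recurrence of \<open>1 / Y\<close>.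
\<close>

lemma det_hessenberg:
  "det (hessenberg y (Suc m) r) =
    - reversal_sign (Suc m) * (\<Sum>k=1..Suc m. y 0 ^ (k - 1) * y (r + k) * inv_series y $ (Suc m - k))"
proof (induction m arbitrary: r)
  case 0
  have "det (hessenberg y (Suc 0) r) = y (Suc r)"
    by (subst laplace_expansion_row[OF hessenberg_carrier, of 0])
      (auto simp: hessenberg_def cofactor_def mat_delete_def)
  then show ?case by (simp add: inv_series_0)
next
  case (Suc m)
  have "det (hessenberg y (Suc m) 0) = reversal_sign (Suc m) * inv_series y $ Suc m"
    unfolding Suc.IH by (simp only: inv_series_recurrence add_0 mult_minus_left mult_minus_right)
  moreover have "(\<Sum>k=1..Suc (Suc m). y 0 ^ (k - 1) * y (r + k) * inv_series y $ (Suc (Suc m) - k)) =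
      y (Suc r) * inv_series y $ Suc m +
      y 0 * (\<Sum>k=1..Suc m. y 0 ^ (k - 1) * y (Suc r + k) * inv_series y $ (Suc m - k))"
    unfolding One_nat_def sum_distrib_left
    by (subst sum.atLeast_Suc_atMost, simp, subst sum.atLeast_Suc_atMost_Suc_shift)
      (auto intro!: sum.cong simp: ac_simps gr0_conv_Suc Suc_le_eq)
  ultimately show ?case
    by (subst det_hessenberg_Suc)
      (simp_all only: Suc.IH reversal_sign.simps(2)[of "Suc m"], simp_all add: algebra_simps)
qed

lemma det_sub_Hankel:
  "det (sub_Hankel n) = reversal_sign n * (inv_series (rev_var n) $ n :: 'k::comm_ring_1 mpoly)"
proof (cases n)
  case (Suc m)
  have "sub_Hankel n = (hessenberg (rev_var n) n 0 :: 'k mpoly mat)"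
    by (rule eq_matI) (auto simp: sub_Hankel_def hessenberg_def rev_var_def intro!: arg_cong[of _ _ Var])
  then show ?thesis using Suc
    by (simp only: det_hessenberg inv_series_recurrence add_0 mult_minus_left mult_minus_right)
qed (simp add: sub_Hankel_def inv_series_0)

text \<open>
  A derivation of the coefficients extends to power series, and
  \<open>D (1 / Y) = - D Y / Y\<^sup>2\<close>.
\<close>

lemma partial_deriv_inv_series:
  "partial_deriv i (inv_series y $ n) =
    - (\<Sum>k=0..n. partial_deriv i (gen_series y $ k) * grad_coeff y (n - k))"
proof -
  define D where "D f = Abs_fps (\<lambda>m. partial_deriv i (f $ m))" for f :: "'a mpoly fps"
  have D_mult: "D (f * g) = D f * g + f * D g" for f g
    by (rule fps_ext) (simp add: D_def fps_mult_nth partial_deriv_sum partial_deriv_mult sum.distrib)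
  have "D 1 = 0" by (rule fps_ext) (simp add: D_def)
  then have "D (gen_series y) * inv_series y + gen_series y * D (inv_series y) = 0"
    using D_mult[of "gen_series y" "inv_series y"] by (simp add: gen_mult_inv_series)
  then have *: "gen_series y * D (inv_series y) = - (D (gen_series y) * inv_series y)"
    by (simp add: eq_neg_iff_add_eq_0 add.commute)
  have "D (inv_series y) = (gen_series y * inv_series y) * D (inv_series y)"
    by (simp only: gen_mult_inv_series mult_1_left)
  also have "\<dots> = inv_series y * (gen_series y * D (inv_series y))" by (simp only: ac_simps)
  also have "\<dots> = - (D (gen_series y) * inv_series y ^ 2)"
    unfolding * by (simp add: power2_eq_square ac_simps)
  finally have "D (inv_series y) $ n = - ((D (gen_series y) * inv_series y ^ 2) $ n)" by simp
  then show ?thesis by (simp add: D_def fps_mult_nth grad_coeff_def)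
qed

lemma partial_deriv_inv_series_pos:
  assumes "1 \<le> k" "k \<le> n"
  shows "partial_deriv (n - k) (inv_series (rev_var n) $ n :: 'k::comm_ring_1 mpoly) =
    - (rev_var n 0 ^ (k - 1) * grad_coeff (rev_var n) (n - k))"
proof -
  have D0: "partial_deriv (n - k) (rev_var n 0) = (0 :: 'k mpoly)"
    using assms by (auto simp: rev_var_def partial_deriv_Var)
  have Dj: "partial_deriv (n - k) (rev_var n j) = (if j = k then 1 else 0 :: 'k mpoly)" if "j \<le> n" for j
    using that assms by (auto simp: rev_var_def partial_deriv_Var)
  have "partial_deriv (n - k) (gen_series (rev_var n) $ j :: 'k mpoly) =
      (if j = k then rev_var n 0 ^ (k - 1) else 0)"
    if "j \<le> n" for j
    using that assms by (auto simp: gen_series_def partial_deriv_mult partial_deriv_power D0 Dj)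
  then have
    "(\<Sum>j=0..n. partial_deriv (n - k) (gen_series (rev_var n) $ j :: 'k mpoly) * grad_coeff (rev_var n) (n - j)) =
      (\<Sum>j=0..n. if j = k then rev_var n 0 ^ (k - 1) * grad_coeff (rev_var n) (n - j) else 0)"
    by (intro sum.cong) auto
  also have "\<dots> = rev_var n 0 ^ (k - 1) * grad_coeff (rev_var n) (n - k)" using assms by simp
  finally show ?thesis unfolding partial_deriv_inv_series by simp
qed

lemma partial_deriv_inv_series_0:
  "partial_deriv n (inv_series (rev_var n) $ n :: 'k::comm_ring_1 mpoly) =
    - (\<Sum>k=2..n. of_nat (k - 1) * rev_var n k * rev_var n 0 ^ (k - 2) * grad_coeff (rev_var n) (n - k))"
proof -
  have D0: "partial_deriv n (rev_var n 0) = (1 :: 'k mpoly)"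
    by (simp add: rev_var_def partial_deriv_Var)
  have Dk: "partial_deriv n (rev_var n k) = (0 :: 'k mpoly)" if "k \<noteq> 0" for k
    using that by (auto simp: rev_var_def partial_deriv_Var)
  have d: "partial_deriv n (gen_series (rev_var n) $ k :: 'k mpoly) =
      (if k < 2 then 0 else of_nat (k - 1) * rev_var n k * rev_var n 0 ^ (k - 2))" for k
  proof (cases "k < 2")
    case True
    then have "k = 0 \<or> k = 1" by auto
    then show ?thesis by (auto simp: gen_series_def Dk)
  next
    case False
    then obtain l where "k = Suc (Suc l)" by (metis add_2_eq_Suc le_Suc_ex not_less)
    moreover have "partial_deriv n (rev_var n 0 ^ Suc l) = (of_nat (Suc l) * rev_var n 0 ^ l :: 'k mpoly)"
      unfolding partial_deriv_power by (simp add: D0)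
    ultimately show ?thesis
      by (simp add: gen_series_def partial_deriv_mult Dk mult.left_commute del: power_Suc of_nat_Suc)
  qed
  have "(\<Sum>k=0..n. partial_deriv n (gen_series (rev_var n) $ k :: 'k mpoly) * grad_coeff (rev_var n) (n - k)) =
     (\<Sum>k=2..n. partial_deriv n (gen_series (rev_var n) $ k) * grad_coeff (rev_var n) (n - k))"
    by (rule sum.mono_neutral_right) (auto simp: d)
  also have "\<dots> =
      (\<Sum>k=2..n. of_nat (k - 1) * rev_var n k * rev_var n 0 ^ (k - 2) * grad_coeff (rev_var n) (n - k))"
    by (intro sum.cong) (auto simp: d)
  finally show ?thesis unfolding partial_deriv_inv_series by simp
qed

lemma sub_Hankel_core_poly_ring:
  assumes "3 \<le> n"
  shows "sub_Hankel_core (carrier (poly_ring n)) (rev_var n)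
    (grad_coeff (rev_var n) :: nat \<Rightarrow> 'k::field_char_0 mpoly)"
proof (intro sub_Hankel_core.intro sub_Hankel_core_axioms.intro)
  show "unital_subring (carrier (poly_ring n) :: 'k mpoly set)"
    by (rule poly_ring.unital_subring_axioms)
  show "poly_ring.unit n (of_nat m :: 'k mpoly)" if "m \<noteq> 0" for m
  proof -
    have "of_nat m * Poly_Mapping.single 0 (inverse (of_nat m)) = (Poly_Mapping.single 0 1 :: 'k mpoly)"
      using that by (simp add: of_nat_single mult_single del: single_of_nat)
    then have "of_nat m * Poly_Mapping.single 0 (inverse (of_nat m)) = (1 :: 'k mpoly)" by simp
    then show ?thesis
      unfolding poly_ring.unit_def by (intro conjI bexI[OF _ carrier_const] poly_ring.of_nat_C)
  qed
  show "poly_ring.prime_in n (poly_ring.vars_ideal n (rev_var n) k :: 'k mpoly set)" if "k \<le> 3" for k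
    using that assms by (intro prime_vars_ideal) simp
  show "(rev_var n k :: 'k mpoly) \<notin> poly_ring.vars_ideal n (rev_var n) k" if "k < 3" for k
    using that assms by (intro rev_var_notin_vars_ideal) simp
qed (rule carrier_rev_var grad_coeff_0 grad_coeff_recurrence)+

section \<open>Associated primes of the gradient ideal\<close>

lemma a_inv_poly_ring:
  fixes x :: "'k::comm_ring_1 mpoly"
  assumes "x \<in> carrier (poly_ring n)"
  shows "a_inv (poly_ring n) x = - x"
proof -
  interpret cring "poly_ring n :: 'k mpoly ring" by (rule cring_poly_ring)
  show ?thesis
    using assms by (intro minus_equality) (simp_all add: poly_ring_simps carrier_uminus)
qed

lemma ideal_iff_ideal_in:
  fixes N :: "'k::comm_ring_1 mpoly set"
  shows "ideal N (poly_ring n) \<longleftrightarrow> poly_ring.ideal_in n N"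
proof
  assume "ideal N (poly_ring n)"
  then interpret ideal N "poly_ring n" .
  show "poly_ring.ideal_in n N"
    using a_subset additive_subgroup.zero_closed[OF additive_subgroup_axioms]
      additive_subgroup.a_closed[OF additive_subgroup_axioms] I_l_closed
    by (intro poly_ring.ideal_inI) (auto simp: poly_ring_simps)
next
  assume N: "poly_ring.ideal_in n N"
  interpret cring "poly_ring n :: 'k mpoly ring" by (rule cring_poly_ring)
  note NC = poly_ring.ideal_C[OF N]
  have "subgroup N (add_monoid (poly_ring n))"
  proof (rule subgroup.intro)
    fix x assume x: "x \<in> N"
    have "inv\<^bsub>add_monoid (poly_ring n)\<^esub> x = - x"
      using a_inv_poly_ring[OF NC[OF x]] by (simp add: a_inv_def)
    then show "inv\<^bsub>add_monoid (poly_ring n)\<^esub> x \<in> N" using poly_ring.ideal_uminus[OF N x] by simp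
  qed (use NC poly_ring.ideal_0[OF N] poly_ring.ideal_add[OF N] in \<open>auto simp: poly_ring_simps\<close>)
  then show "ideal N (poly_ring n)"
    using poly_ring.ideal_mult[OF N] poly_ring.ideal_mult'[OF N]
    by (intro idealI ring_axioms) (auto simp: poly_ring_simps)
qed

lemma genideal_eqI:
  assumes "poly_ring.ideal_in n N" "S \<subseteq> N"
    and "\<And>N'. poly_ring.ideal_in n N' \<Longrightarrow> S \<subseteq> N' \<Longrightarrow> N \<subseteq> N'"
  shows "Idl\<^bsub>poly_ring n\<^esub> S = N"
  unfolding genideal_def ideal_iff_ideal_in using assms by blast

text \<open>
  The annihilator of the class of \<open>x\<close> in \<open>R / J\<close> is the ideal quotient \<open>J : x\<close>, which reduces the
  statement about the quotient module to ideals of the polynomial ring.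
\<close>

lemma associated_primes_poly_ring_quotient:
  fixes J :: "'k::comm_ring_1 mpoly set"
  assumes J: "poly_ring.ideal_in n J"
  shows "associated_primes (poly_ring n) (quotient_module (poly_ring n) J) =
    {p. poly_ring.prime_in n p \<and> (\<exists>x\<in>carrier (poly_ring n). p = poly_ring.colon n J x)}"
proof -
  let ?R = "poly_ring n :: 'k mpoly ring"
  interpret cring ?R by (rule cring_poly_ring)
  interpret J: ideal J ?R using J by (simp add: ideal_iff_ideal_in)
  have in_iff: "J +>\<^bsub>?R\<^esub> z = J \<longleftrightarrow> z \<in> J" if "z \<in> carrier ?R" for z
    using that J.a_rcos_const J.a_rcos_self by blast
  have mult: "rcoset_mult ?R J (J +>\<^bsub>?R\<^esub> a) (J +>\<^bsub>?R\<^esub> x) = J \<longleftrightarrow> a * x \<in> J"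
    if "a \<in> carrier ?R" "x \<in> carrier ?R" for a x
    using in_iff[of "a * x"] carrier_mult[OF that] J.rcoset_mult_add[OF that]
    by (simp add: poly_ring_simps)
  have ann: "annihilator ?R (quotient_module ?R J) (J +>\<^bsub>?R\<^esub> x) = poly_ring.colon n J x"
    if "x \<in> carrier ?R" for x
    using mult[OF _ that]
    by (simp add: annihilator_def quotient_module_def FactRing_def poly_ring.colon_def cong: conj_cong)
  have carrier: "carrier (quotient_module ?R J) = (\<lambda>x. J +>\<^bsub>?R\<^esub> x) ` carrier ?R"
    by (auto simp: quotient_module_def FactRing_def A_RCOSETS_def')
  have prime: "primeideal p ?R \<longleftrightarrow> poly_ring.prime_in n p" if p: "poly_ring.ideal_in n p" for p
  proof
    assume "primeideal p ?R"
    then interpret primeideal p ?R .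
    show "poly_ring.prime_in n p"
      unfolding poly_ring.prime_in_def using I_prime I_notcarr one_imp_carrier
      by (auto simp: poly_ring_simps)
  next
    assume "poly_ring.prime_in n p"
    then show "primeideal p ?R"
      using p carrier_one unfolding poly_ring.prime_in_def
      by (intro primeidealI) (auto simp: ideal_iff_ideal_in poly_ring_simps is_cring)
  qed
  show ?thesis
    unfolding associated_primes_def carrier
    using prime[OF poly_ring.ideal_colon[OF J]] by (auto simp: ann)
qed

text \<open>
  The partial derivatives of the determinant are the generators of \<open>K\<close> up to a common sign.
\<close>

lemma gradient_ideal_eq:
  fixes n :: nat
  assumes n: "3 \<le> n"
  defines "y \<equiv> rev_var n :: nat \<Rightarrow> 'k::field_char_0 mpoly"
  defines "E \<equiv> \<Sum>k=2..n. of_nat (k - 1) * y k * y 0 ^ (k - 2) * grad_coeff y (n - k)"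
  shows "gradient_ideal n (det (sub_Hankel n)) =
    sub_Hankel_core.K (carrier (poly_ring n)) y (grad_coeff y) (n - 2) E"
proof -
  interpret sub_Hankel_core "carrier (poly_ring n)" y "grad_coeff y"
    unfolding y_def by (rule sub_Hankel_core_poly_ring[OF n])
  let ?D = "\<lambda>i. partial_deriv i (det (sub_Hankel n) :: 'k mpoly)"
  have n2: "n - 2 + 2 = n" using n by simp
  have extra_gen: "extra_gen (n - 2) 1 E"
    using extra_gen_y0_derivative[of "n - 2"] unfolding E_def n2 .
  note K = ideal_K[OF extra_gen_C[OF extra_gen], of "n - 2"]
  obtain s :: "'k mpoly" where s: "s = 1 \<or> s = -1" "det (sub_Hankel n) = s * inv_series y $ n"
    using det_sub_Hankel[of n] reversal_sign_cases[of n] unfolding y_def by metis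
  have D: "?D i = s * partial_deriv i (inv_series y $ n)" for i
    using s by (auto simp: partial_deriv_uminus)
  have Dpos: "?D (n - Suc k) = - s * (y 0 ^ k * grad_coeff y (n - Suc k))" if "k < n" for k
    using that unfolding D y_def by (simp add: partial_deriv_inv_series_pos[of "Suc k"])
  have D0: "?D n = - s * E"
    unfolding D E_def y_def partial_deriv_inv_series_0 by simp
  have sC: "- s \<in> carrier (poly_ring n)" "- s * (- s) = 1"
    using s(1) carrier_one carrier_uminus by auto
  have index: "i = n \<or> (\<exists>k<n. i = n - Suc k)" if "i \<le> n" for i
    using that by (cases "i = n") (auto intro!: exI[of _ "n - Suc i"])
  show ?thesis
    unfolding gradient_ideal_def
  proof (rule genideal_eqI[OF K])
    show "{?D i | i. i \<le> n} \<subseteq> K (n - 2) E"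
    proof clarify
      fix i assume "i \<le> n"
      from index[OF this] show "?D i \<in> K (n - 2) E"
      proof (elim disjE exE conjE)
        assume "i = n"
        then show ?thesis using D0 poly_ring.ideal_mult[OF K sC(1) E_in_K] by simp
      next
        fix k assume k: "k < n" "i = n - Suc k"
        have "y 0 ^ k * grad_coeff y (n - Suc k) \<in> K (n - 2) E"
          using y0_power_G_in_I[OF k(1)] by (intro I_in_K) (simp only: n2)
        then show ?thesis unfolding k(2) Dpos[OF k(1)] by (rule poly_ring.ideal_mult[OF K sC(1)])
      qed
    qed
    fix N assume N: "poly_ring.ideal_in n N" and sub: "{?D i | i. i \<le> n} \<subseteq> N"
    have cancel: "a \<in> N" if "- s * a \<in> N" for a
    proof -
      have "- s * (- s * a) \<in> N" using poly_ring.ideal_mult[OF N sC(1)] that by blast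
      then show ?thesis using sC(2) by (metis mult.assoc mult_1_left)
    qed
    have "?D n \<in> N" using sub by blast
    then have "E \<in> N" unfolding D0 by (rule cancel)
    moreover have "I n \<subseteq> N"
    proof
      fix a assume "a \<in> I n"
      moreover have "y 0 ^ (0 + k) * grad_coeff y (n - Suc k) \<in> N" if "k < n" for k
      proof -
        have "n - Suc k \<le> n" by simp
        then have "?D (n - Suc k) \<in> N" using sub by blast
        then show ?thesis unfolding Dpos[OF that] using cancel by simp
      qed
      ultimately show "a \<in> N" using I_least[OF N, of n 0 a] by simp
    qed
    ultimately show "K (n - 2) E \<subseteq> N"
      unfolding K_def n2 using poly_ring.ideal_add[OF N] poly_ring.ideal_mult[OF N] by blast
  qed
qed

lemma genideal_Vars:
  assumes n: "k \<le> n"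
  shows "Idl\<^bsub>poly_ring n\<^esub> ((\<lambda>i. Var (n - i)) ` {..<k}) =
    (poly_ring.vars_ideal n (rev_var n) k :: 'k::comm_ring_1 mpoly set)"
proof (rule genideal_eqI)
  show "poly_ring.ideal_in n (poly_ring.vars_ideal n (rev_var n :: nat \<Rightarrow> 'k mpoly) k)"
    by (rule poly_ring.ideal_vars_ideal) (rule carrier_rev_var)
  have rev_var: "rev_var n i = Var (n - i)" if "i < k" for i
    using that n by (simp add: rev_var_def)
  show "(\<lambda>i. Var (n - i)) ` {..<k} \<subseteq> (poly_ring.vars_ideal n (rev_var n) k :: 'k mpoly set)"
  proof clarify
    fix i assume i: "i < k"
    have "kill_vars {n - i | i. i < k} (rev_var n i :: 'k mpoly) = 0"
      using i by (auto simp: rev_var kill_vars_Var)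
    then have "(rev_var n i :: 'k mpoly) \<in> poly_ring.vars_ideal n (rev_var n) k"
      using n by (simp add: vars_ideal_iff_kill_vars carrier_rev_var)
    then show "(Var (n - i) :: 'k mpoly) \<in> poly_ring.vars_ideal n (rev_var n) k"
      by (simp add: rev_var[OF i])
  qed
  fix N :: "'k mpoly set"
  assume N: "poly_ring.ideal_in n N" and sub: "(\<lambda>i. Var (n - i)) ` {..<k} \<subseteq> N"
  show "poly_ring.vars_ideal n (rev_var n) k \<subseteq> N"
  proof
    fix a :: "'k mpoly" assume "a \<in> poly_ring.vars_ideal n (rev_var n) k"
    then obtain r where r: "\<forall>i<k. r i \<in> carrier (poly_ring n)" "a = (\<Sum>i<k. rev_var n i * r i)"
      unfolding poly_ring.vars_ideal_def by blast
    show "a \<in> N"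
      unfolding r(2)
    proof (rule poly_ring.ideal_sum[OF N])
      fix i assume i: "i \<in> {..<k}"
      then have "rev_var n i \<in> N" using sub rev_var by auto
      then show "rev_var n i * r i \<in> N" using poly_ring.ideal_mult'[OF N] r(1) i by simp
    qed
  qed
qed

theorem theorem4p6:
  fixes n :: nat
    and R :: "('k::field_char_0 mpoly) ring"
    and f :: "'k mpoly"
    and J :: "'k mpoly set"
  assumes "3 \<le> n"
  defines "R \<equiv> poly_ring n"
    and "f \<equiv> det (sub_Hankel n)"
    and "J \<equiv> gradient_ideal n f"
  shows "associated_primes R (quotient_module R J) =
           {Idl\<^bsub>R\<^esub> {Var (n - 1), Var n}, Idl\<^bsub>R\<^esub> {Var (n - 2), Var (n - 1), Var n}}"
proof -
  define y :: "nat \<Rightarrow> 'k mpoly" where "y = rev_var n"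
  interpret sub_Hankel_core "carrier (poly_ring n)" y "grad_coeff y"
    unfolding y_def by (rule sub_Hankel_core_poly_ring[OF assms(1)])
  define E where "E = (\<Sum>k=2..n. of_nat (k - 1) * y k * y 0 ^ (k - 2) * grad_coeff y (n - k))"
  have J: "J = K (n - 2) E"
    unfolding J_def f_def E_def y_def by (rule gradient_ideal_eq[OF assms(1)])
  obtain j where j: "n - 2 = Suc j" using assms(1) by (cases "n - 2") auto
  have "Suc j + 2 = n" using assms(1) j by simp
  then have extra_gen: "extra_gen (Suc j) (Suc 0) E"
    using extra_gen_y0_derivative[of "Suc j"] unfolding E_def by (simp only: One_nat_def)
  have P: "Idl\<^bsub>R\<^esub> {Var (n - 1), Var n} = V 2"
  proof -
    have "(\<lambda>i. Var (n - i)) ` {..<2} = {Var (n - 1), Var n :: 'k mpoly}"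
      by (auto simp: numeral_2_eq_2 lessThan_Suc)
    from this[symmetric] show ?thesis
      unfolding R_def y_def by (simp only:) (rule genideal_Vars, use assms(1) in simp)
  qed
  have Q: "Idl\<^bsub>R\<^esub> {Var (n - 2), Var (n - 1), Var n} = V 3"
  proof -
    have "(\<lambda>i. Var (n - i)) ` {..<3} = {Var (n - 2), Var (n - 1), Var n :: 'k mpoly}"
      by (auto simp: numeral_3_eq_3 numeral_2_eq_2 lessThan_Suc)
    from this[symmetric] show ?thesis
      unfolding R_def y_def by (simp only:) (rule genideal_Vars, use assms(1) in simp)
  qed
  show ?thesis
    unfolding P Q unfolding R_def J j
    by (simp only: associated_primes_poly_ring_quotient[OF ideal_K[OF extra_gen_C[OF extra_gen]]]
        associated_primes_K[OF extra_gen])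
qed

end
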